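(* Let $q\in(0,1]$. Assume: [A2] $p$ is differentiable on $\mathbb R\setminus\{0\}$; [A5] there exists $\lambda>0$ with $\lim_{x\to0}p(x)/|x|^q=\lambda$; [A6] for every $j\in\mathcal J^{(0)}$, $(\xi_T^j)^{-1/q}|\alpha_T^j|^{-1}\to0$ in probability; [A10] (LAQ) there exist random vectors $\Delta_T,\Delta\in\mathbb R^{\mathsf p}$, random matrices $\Gamma_T,\Gamma\in\mathbb R^{\mathsf p\times\mathsf p}$ and random fields $r_T$ on $\mathbb U_T$ such that (i) $\mathbb H_T(\theta^*+a_Tu)-\mathbb H_T(\theta^* )=\Delta_T'u-\tfrac12u'\Gamma_Tu+r_T(u)$ for all $T\in\mathbb T$, $u\in\mathbb U_T$; (ii) $\Gamma$ is almost surely positive definite; (iii) $(\Delta_T,\Gamma_T)\to(\Delta,\Gamma)$ in distribution; (iv) for all $R>0$, $\sup_{|u|\le R,\,u\in\mathbb U_T}|r_T(u)|\to0$ in probability; [A11] for every $j\in\mathcal J^{(1)}$ there is a constant $\beta_j\in\mathbb R$ with $\xi_T^j\alpha_T^j\to\beta_j$ in probability. If $\tilde u_T=\tilde a_T^{-1}(\hat\theta_T-\theta^* )=O_p(1)$, then as $T\to\infty$ $$(\tilde a_T^{(00)})^{-1}(\hat\theta_T^{(0)}-\theta^{*(0)})\to0\ \text{in probability}$$ and $$(\tilde a_T^{(11)})^{-1}(\hat\theta_T^{(1)}-\theta^{*(1)})\to(\Gamma^{(11)})^{-1}(\Delta^{(1)}-\psi^{(1)})\ \text{in distribution},$$ where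 $\psi^{(1)}=(\beta_jp'(\theta^*_j))_{j\in\mathcal J^{(1)}}$.
   Context: Let $\Theta\subset\mathbb R^{\mathsf p}$ be a bounded open set with closure $\overline\Theta$ and $\theta^*\in\Theta$. Let $(\Omega,\mathcal F,P)$ be a probability space, $\mathbb T\subset\mathbb R_{\ge0}$ with $\sup\mathbb T=\infty$; limits $T\to\infty$ are along $\mathbb T$. For each $T\in\mathbb T$, $\mathbb H_T:\Omega\times\overline\Theta\to\mathbb R$ is a random field continuous in $\theta$ for every $\omega$. The penalty is $p_T(\theta)=\sum_{j=1}^{\mathsf p}\xi_T^jp(\theta_j)$ with (possibly random) $\xi_T^j>0$ and $p:\mathbb R\to\mathbb R_{\ge0}$, $p(0)=0$; $\mathbb H^\dagger_T=\mathbb H_T-p_T$, and $\hat\theta_T:\Omega\to\overline\Theta$ is measurable with $\mathbb H^\dagger_T(\hat\theta_T)=\max_{\overline\Theta}\mathbb H^\dagger_T$. $\mathcal J^{(0)}=\{j:\theta^*_j=0\}$, $\mathcal J^{(1)}=\{j:\theta^*_j\ne0\}$; for $x\in\mathbb R^{\mathsf p}$, $x^{(k)}=(x_j)_{j\in\mathcal J^{(k)}}$, and for a matrix $A$, $A^{(kl)}=(A_{ij})_{i\in\mathcal J^{(k)},j\in\mathcal J^{(l)}}$. $a_T=\mathrm{diag}(\alpha_T^1,\dots,\alpha_T^{\mathsf p})$ is deterministic, invertible, with $\|a_T\|\to0$ ($\|\cdot\|$ spectral norm); $\mathbb U_T=\{u:\theta^*+a_Tu\in\overline\Theta\}$. $\tilde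 a_T$ is diagonal with $(\tilde a_T)_{jj}=(\xi_T^j)^{-1/q}$ for $j\in\mathcal J^{(0)}$ and $\alpha_T^j$ for $j\in\mathcal J^{(1)}$. $X_T=O_p(1)$ means tightness. *)

theory Defs
  imports "HOL-Probability.Probability"
begin

definition along :: "real set \<Rightarrow> real filter" where
  "along TT = inf at_top (principal TT)"

definition conv_prob ::
  "'a measure \<Rightarrow> real filter \<Rightarrow> (real \<Rightarrow> 'a \<Rightarrow> 'b::metric_space) \<Rightarrow> ('a \<Rightarrow> 'b) \<Rightarrow> bool" where
  "conv_prob P F X Y \<longleftrightarrow>
     (\<forall>e>0. ((\<lambda>T. measure P {\<omega> \<in> space P. dist (X T \<omega>) (Y \<omega>) > e}) \<longlongrightarrow> 0) F)"

definition conv_distr ::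
  "'a measure \<Rightarrow> real filter \<Rightarrow> (real \<Rightarrow> 'a \<Rightarrow> 'b::metric_space) \<Rightarrow> ('a \<Rightarrow> 'b) \<Rightarrow> bool" where
  "conv_distr P F X Y \<longleftrightarrow>
     (\<forall>f :: 'b \<Rightarrow> real. continuous_on UNIV f \<and> bounded (range f) \<longrightarrow>
        ((\<lambda>T. \<integral>\<omega>. f (X T \<omega>) \<partial>P) \<longlongrightarrow> (\<integral>\<omega>. f (Y \<omega>) \<partial>P)) F)"

definition tight_family ::
  "'a measure \<Rightarrow> real set \<Rightarrow> (real \<Rightarrow> 'a \<Rightarrow> 'b::real_normed_vector) \<Rightarrow> bool" where
  "tight_family P TT X \<longleftrightarrow>
     (\<forall>e>0. \<exists>M. \<forall>T\<in>TT. measure P {\<omega> \<in> space P. norm (X T \<omega>) > M} \<le> e)"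

definition diag_mat :: "real^'n \<Rightarrow> real^'n^'n" where
  "diag_mat v = (\<chi> i j. if i = j then v $ i else 0)"

definition pos_def :: "real^'n^'n \<Rightarrow> bool" where
  "pos_def M \<longleftrightarrow> transpose M = M \<and> (\<forall>x. x \<noteq> 0 \<longrightarrow> x \<bullet> (M *v x) > 0)"

definition sub_vec :: "'n set \<Rightarrow> real^'n \<Rightarrow> real^'n" where
  "sub_vec J x = (\<chi> j. if j \<in> J then x $ j else 0)"

text \<open>(M^(JJ))^(-1), embedded as the inverse of the block matrix diag(M^(JJ), I);
  applied to vectors supported on J it acts as (M^(JJ))^(-1).\<close>
definition sub_inv :: "'n set \<Rightarrow> real^'n^'n \<Rightarrow> real^'n^'n" where
  "sub_inv J M = matrix_inv (\<chi> i j. if i \<in> J \<and> j \<in> J then M $ i $ j else if i = j then 1 else 0)"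

end

theory Submission
  imports Defs
begin

text \<open>
  Put \<open>u = a_T^{-1} (\<theta>h - \<theta>s)\<close>.  By [A6] and tightness its coordinates in \<open>J0\<close> vanish in the limit.
  Comparing the maximiser with the point obtained from it by setting the \<open>J0\<close> coordinates to 0, the
  quadratic expansion shows that the penalty paid on \<open>J0\<close> tends to 0, and [A5] turns this penalty into
  \<open>lam\<close> times the \<open>q\<close>-th power of the normalised
  coordinates \<open>\<bar>\<xi>_j^{1/q} * \<theta>h_j\<bar>\<close>.  Comparing it with points differing only on \<open>J1\<close>, where the penalty is
  asymptotically linear with slope \<open>\<psi>\<close>, every limit point on \<open>J1\<close> is a critical point of the limiting
  quadratic criterion, and positive definiteness makes that point unique.

  These arguments are deterministic and are run along convergent subsequences; compactness makes them
  uniform over all outcomes with \<open>(\<Delta>_T, \<Gamma>_T)\<close> in a fixed compact set of pairs with positive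
  quadratic form.  Convergence in distribution puts \<open>(\<Delta>_T, \<Gamma>_T)\<close> into such a set with
  probability close to 1, so a combined continuous mapping and Slutsky argument finishes the proof.
\<close>

section \<open>Convergence in probability and in distribution\<close>

text \<open>An event holds \<^emph>\<open>with high probability\<close> if it holds off a measurable set of small measure; the
  event itself need not be measurable.\<close>

definition whp :: "'a measure \<Rightarrow> real filter \<Rightarrow> (real \<Rightarrow> 'a \<Rightarrow> bool) \<Rightarrow> bool" where
  "whp P F Q \<longleftrightarrow>
     (\<forall>\<epsilon>>0. \<forall>\<^sub>F T in F. \<exists>B\<in>sets P. measure P B \<le> \<epsilon> \<and> (\<forall>\<omega>\<in>space P - B. Q T \<omega>))"

lemma whp_mono:
  assumes "whp P F Q" "\<forall>\<^sub>F T in F. \<forall>\<omega>\<in>space P. Q T \<omega> \<longrightarrow> Q' T \<omega>"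
  shows "whp P F Q'"
  unfolding whp_def
proof (intro allI impI)
  fix \<epsilon> :: real assume "\<epsilon> > 0"
  with assms(1) have "\<forall>\<^sub>F T in F. \<exists>B\<in>sets P. measure P B \<le> \<epsilon> \<and> (\<forall>\<omega>\<in>space P - B. Q T \<omega>)"
    by (auto simp: whp_def)
  with assms(2) show "\<forall>\<^sub>F T in F. \<exists>B\<in>sets P. measure P B \<le> \<epsilon> \<and> (\<forall>\<omega>\<in>space P - B. Q' T \<omega>)"
    by eventually_elim blast
qed

lemma whp_always: "\<forall>\<^sub>F T in F. \<forall>\<omega>\<in>space P. Q T \<omega> \<Longrightarrow> whp P F Q"
  unfolding whp_def
  by (intro allI impI, erule eventually_mono) (auto intro!: bexI[of _ "{}"])

text \<open>The event \<open>A\<close> may depend on \<epsilon>, as it must when it is given by a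
  compact set or a radius chosen from \<epsilon>. Half of \<epsilon> pays for leaving
  \<open>A\<close>, the other half for the exceptional set of the conditional statement.\<close>

lemma whp_localize:
  assumes "prob_space P"
  assumes loc: "\<And>\<epsilon>. \<epsilon> > 0 \<Longrightarrow>
    \<exists>A. (\<forall>\<^sub>F T in F. \<exists>B\<in>sets P. measure P B \<le> \<epsilon> \<and> (\<forall>\<omega>\<in>space P - B. A T \<omega>))
        \<and> whp P F (\<lambda>T \<omega>. A T \<omega> \<longrightarrow> Q T \<omega>)"
  shows "whp P F Q"
  unfolding whp_def
proof (intro allI impI)
  interpret prob_space P by fact
  fix \<epsilon> :: real assume e: "\<epsilon> > 0"
  obtain A where A: "\<forall>\<^sub>F T in F. \<exists>B\<in>sets P. measure P B \<le> \<epsilon>/2 \<and> (\<forall>\<omega>\<in>space P - B. A T \<omega>)"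
    "whp P F (\<lambda>T \<omega>. A T \<omega> \<longrightarrow> Q T \<omega>)"
    using loc[OF half_gt_zero[OF e]] by (elim exE conjE) (rule that)
  from A(2) e have "\<forall>\<^sub>F T in F. \<exists>B\<in>sets P. measure P B \<le> \<epsilon>/2 \<and> (\<forall>\<omega>\<in>space P - B. A T \<omega> \<longrightarrow> Q T \<omega>)"
    unfolding whp_def using half_gt_zero by blast
  with A(1) show "\<forall>\<^sub>F T in F. \<exists>B\<in>sets P. measure P B \<le> \<epsilon> \<and> (\<forall>\<omega>\<in>space P - B. Q T \<omega>)"
  proof eventually_elim
    case (elim T)
    then obtain B1 B2 where B: "B1 \<in> sets P" "B2 \<in> sets P"
      "measure P B1 \<le> \<epsilon>/2" "measure P B2 \<le> \<epsilon>/2"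
      "\<forall>\<omega>\<in>space P - B1. A T \<omega>" "\<forall>\<omega>\<in>space P - B2. A T \<omega> \<longrightarrow> Q T \<omega>"
      by blast
    then have "measure P (B1 \<union> B2) \<le> \<epsilon>"
      using measure_Un_le[of B1 P B2] by auto
    with B show ?case
      by (intro bexI[of _ "B1 \<union> B2"]) auto
  qed
qed

lemma whp_conj:
  assumes "prob_space P" "whp P F Q" "whp P F Q'"
  shows "whp P F (\<lambda>T \<omega>. Q T \<omega> \<and> Q' T \<omega>)"
proof (rule whp_localize[OF assms(1)])
  fix \<epsilon> :: real assume "\<epsilon> > 0"
  then show "\<exists>A. (\<forall>\<^sub>F T in F. \<exists>B\<in>sets P. measure P B \<le> \<epsilon> \<and> (\<forall>\<omega>\<in>space P - B. A T \<omega>))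
        \<and> whp P F (\<lambda>T \<omega>. A T \<omega> \<longrightarrow> Q T \<omega> \<and> Q' T \<omega>)"
    using assms(2) whp_mono[OF assms(3), of "\<lambda>T \<omega>. Q T \<omega> \<longrightarrow> Q T \<omega> \<and> Q' T \<omega>"]
    by (intro exI[of _ Q]) (auto simp: whp_def)
qed

lemma whp_ball_finite:
  assumes "prob_space P" "finite J" "\<And>j. j \<in> J \<Longrightarrow> whp P F (Q j)"
  shows "whp P F (\<lambda>T \<omega>. \<forall>j\<in>J. Q j T \<omega>)"
  using assms(2,3)
proof (induction J)
  case empty
  then show ?case by (simp add: whp_always)
next
  case (insert j J)
  then show ?case using whp_conj[OF assms(1), of F "Q j" "\<lambda>T \<omega>. \<forall>j\<in>J. Q j T \<omega>"] by simp
qed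

text \<open>Measurability of the exceedance events is essential: \<open>measure\<close> is 0 on
  non-measurable sets, so for those \<open>conv_prob\<close> alone would carry no
  information.\<close>

lemma whp_of_conv_prob:
  fixes X :: "real \<Rightarrow> 'a \<Rightarrow> 'b::metric_space"
  assumes "conv_prob P F X Y" "e > 0"
    and "\<forall>\<^sub>F T in F. {\<omega> \<in> space P. dist (X T \<omega>) (Y \<omega>) > e} \<in> sets P"
  shows "whp P F (\<lambda>T \<omega>. dist (X T \<omega>) (Y \<omega>) \<le> e)"
  unfolding whp_def
proof (intro allI impI)
  fix \<epsilon> :: real assume "\<epsilon> > 0"
  have "((\<lambda>T. measure P {\<omega> \<in> space P. dist (X T \<omega>) (Y \<omega>) > e}) \<longlongrightarrow> 0) F"
    using assms(1,2) by (simp add: conv_prob_def)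
  from order_tendstoD(2)[OF this \<open>\<epsilon> > 0\<close>] assms(3)
  show "\<forall>\<^sub>F T in F. \<exists>B\<in>sets P. measure P B \<le> \<epsilon> \<and> (\<forall>\<omega>\<in>space P - B. dist (X T \<omega>) (Y \<omega>) \<le> e)"
  proof eventually_elim
    case (elim T)
    then show ?case
      by (intro bexI[of _ "{\<omega> \<in> space P. dist (X T \<omega>) (Y \<omega>) > e}"]) auto
  qed
qed

text \<open>No measurability is needed here because \<^const>\<open>measure\<close> vanishes on non-measurable sets.\<close>

lemma conv_prob_of_whp:
  fixes X :: "real \<Rightarrow> 'a \<Rightarrow> 'b::metric_space"
  assumes "prob_space P" "\<And>e. e > 0 \<Longrightarrow> whp P F (\<lambda>T \<omega>. dist (X T \<omega>) (Y \<omega>) \<le> e)"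
  shows "conv_prob P F X Y"
  unfolding conv_prob_def
proof (intro allI impI tendstoI)
  interpret prob_space P by fact
  fix e d :: real assume "e > 0" "d > 0"
  from assms(2)[OF \<open>e > 0\<close>] \<open>d > 0\<close>
  have "\<forall>\<^sub>F T in F. \<exists>B\<in>sets P. measure P B \<le> d/2 \<and> (\<forall>\<omega>\<in>space P - B. dist (X T \<omega>) (Y \<omega>) \<le> e)"
    unfolding whp_def using half_gt_zero by blast
  then show "\<forall>\<^sub>F T in F. dist (measure P {\<omega> \<in> space P. dist (X T \<omega>) (Y \<omega>) > e}) 0 < d"
  proof eventually_elim
    case (elim T)
    then obtain B where B: "B \<in> sets P" "measure P B \<le> d/2"
      "\<forall>\<omega>\<in>space P - B. dist (X T \<omega>) (Y \<omega>) \<le> e" by blast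
    then have "measure P {\<omega> \<in> space P. dist (X T \<omega>) (Y \<omega>) > e} \<le> measure P B"
      by (intro finite_measure_mono) (auto simp: not_le[symmetric])
    with B \<open>d > 0\<close> show ?case by simp
  qed
qed

lemma integrable_continuous_bounded_comp:
  fixes f :: "'b::topological_space \<Rightarrow> real"
  assumes "prob_space P" "continuous_on UNIV f" "\<And>x. \<bar>f x\<bar> \<le> C" "X \<in> borel_measurable P"
  shows "integrable P (\<lambda>\<omega>. f (X \<omega>))"
proof -
  interpret prob_space P by fact
  have "(\<lambda>\<omega>. f (X \<omega>)) \<in> borel_measurable P"
    using assms(2,4) borel_measurable_continuous_onI measurable_compose by blast
  then show ?thesis
    using assms(3) by (intro integrable_const_bound[of _ C]) auto
qed

text \<open>The cutoff turns a function that is continuous only on an open set carrying the limit law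
  into a globally continuous test function.\<close>

lemma compact_cutoff:
  fixes G :: "'b::euclidean_space set"
  assumes P: "prob_space P" and Z: "Z \<in> borel_measurable P" and G: "open G"
    and ae: "AE \<omega> in P. Z \<omega> \<in> G" and "\<epsilon> > 0"
  obtains K and \<kappa> :: "'b \<Rightarrow> real"
  where "compact K" "K \<subseteq> G" "continuous_on UNIV \<kappa>"
    "\<And>z. 0 \<le> \<kappa> z" "\<And>z. \<kappa> z \<le> 1" "\<And>z. z \<notin> K \<Longrightarrow> \<kappa> z = 0"
    "(\<integral>\<omega>. \<kappa> (Z \<omega>) \<partial>P) > 1 - \<epsilon>"
proof -
  interpret prob_space P by fact
  \<comment> \<open>An exhaustion of \<open>G\<close> by compact sets, each inside the interior of
    the next; by continuity from below some \<open>C n\<close> already has mass above 1 -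
    \<epsilon>.\<close>
  obtain C where C: "\<And>n::nat. compact (C n)" "\<And>n. C n \<subseteq> G" "\<And>n. C n \<subseteq> interior (C (Suc n))"
    "\<Union>(range C) = G"
    using open_Union_compact_subsets[OF G] by metis
  define E where "E n = Z -` C n \<inter> space P" for n
  have CC: "C n \<subseteq> C (Suc n)" for n using C(3) interior_subset by blast
  have E_sets: "E n \<in> sets P" for n
    unfolding E_def using Z C(1) by (auto intro!: measurable_sets compact_imp_closed borel_closed)
  have "incseq E"
    unfolding E_def by (rule incseq_SucI) (use CC in blast)
  then have "(\<lambda>n. prob (E n)) \<longlonglongrightarrow> prob (\<Union>n. E n)"
    using E_sets by (intro finite_Lim_measure_incseq) auto
  moreover have "prob (\<Union>n. E n) = 1"
  proof -
    have "AE \<omega> in P. \<omega> \<in> (\<Union>n. E n)"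
      using ae AE_space by eventually_elim (use C(4) in \<open>auto simp: E_def\<close>)
    then show ?thesis using E_sets by (subst prob_eq_1) auto
  qed
  ultimately have "\<forall>\<^sub>F n in sequentially. prob (E n) > 1 - \<epsilon>"
    using \<open>\<epsilon> > 0\<close> by (intro order_tendstoD(1)) auto
  then obtain n where n: "prob (E n) > 1 - \<epsilon>"
    by (auto simp: eventually_sequentially)
  \<comment> \<open>The cutoff is 1 on \<open>C n\<close> and 0 off the interior of
    \<open>C (Suc n)\<close>, so \<open>C (Suc n)\<close> is the compact set returned.\<close>
  obtain \<kappa> :: "'b \<Rightarrow> real" where chi: "continuous_on UNIV \<kappa>" "\<And>x. \<kappa> x \<in> closed_segment 1 0"
    "\<And>x. x \<in> C n \<Longrightarrow> \<kappa> x = 1" "\<And>x. x \<in> - interior (C (Suc n)) \<Longrightarrow> \<kappa> x = 0"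
  proof (rule Urysohn[of "C n" "- interior (C (Suc n))" "1::real" 0])
    show "closed (C n)" using C(1) by (simp add: compact_imp_closed)
    show "C n \<inter> - interior (C (Suc n)) = {}" using C(3)[of n] by blast
  qed (use that in auto)
  have b: "0 \<le> \<kappa> x" "\<kappa> x \<le> 1" for x
    using chi(2)[of x] by (auto simp: closed_segment_eq_real_ivl)
  have "prob (E n) = (\<integral>\<omega>. indicator (E n) \<omega> \<partial>P)"
    using E_sets by simp
  also have "\<dots> \<le> (\<integral>\<omega>. \<kappa> (Z \<omega>) \<partial>P)"
  proof (rule integral_mono)
    show "integrable P (indicator (E n) :: _ \<Rightarrow> real)"
      using E_sets by (simp add: integrable_indicator_iff emeasure_eq_measure)
    show "integrable P (\<lambda>\<omega>. \<kappa> (Z \<omega>))"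
      using b by (intro integrable_continuous_bounded_comp[OF P chi(1), of 1] Z) (simp add: abs_le_iff)
    show "indicator (E n) \<omega> \<le> \<kappa> (Z \<omega>)" for \<omega>
      using b chi(3) by (auto simp: E_def indicator_def)
  qed
  finally have "(\<integral>\<omega>. \<kappa> (Z \<omega>) \<partial>P) > 1 - \<epsilon>" using n by simp
  moreover have "\<kappa> z = 0" if "z \<notin> C (Suc n)" for z
    using chi(4) that interior_subset by blast
  ultimately show ?thesis
    using that[of "C (Suc n)" \<kappa>] C(1,2) chi(1) b by blast
qed

lemma conv_distr_integral:
  assumes "conv_distr P F ZT Z" "continuous_on UNIV f" "\<And>x. \<bar>f x\<bar> \<le> (C::real)"
  shows "((\<lambda>T. \<integral>\<omega>. f (ZT T \<omega>) \<partial>P) \<longlongrightarrow> (\<integral>\<omega>. f (Z \<omega>) \<partial>P)) F"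
proof -
  have "bounded (range f)"
    using assms(3) by (auto simp: bounded_iff)
  with assms(1,2) show ?thesis by (auto simp: conv_distr_def)
qed

text \<open>The cutoff is a continuous minorant of the indicator of \<open>K\<close>, so convergence
  of its expectations eventually lifts the probability of \<open>K\<close> to at least 1 -
  \<epsilon>. Compared with tightness, the gain is that \<open>K\<close> lies inside the open set
  carrying the limit law.\<close>

lemma conv_distr_eventually_in_compact:
  fixes G :: "'b::euclidean_space set"
  assumes P: "prob_space P" and conv: "conv_distr P F ZT Z"
    and ZT: "\<forall>\<^sub>F T in F. ZT T \<in> borel_measurable P" and Z: "Z \<in> borel_measurable P"
    and G: "open G" "AE \<omega> in P. Z \<omega> \<in> G" and "\<epsilon> > 0"
  shows "\<exists>K. compact K \<and> K \<subseteq> G \<and>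
    (\<forall>\<^sub>F T in F. \<exists>B\<in>sets P. measure P B \<le> \<epsilon> \<and> (\<forall>\<omega>\<in>space P - B. ZT T \<omega> \<in> K))"
proof -
  interpret prob_space P by fact
  obtain K and \<kappa> :: "'b \<Rightarrow> real" where K: "compact K" "K \<subseteq> G" "continuous_on UNIV \<kappa>"
    "\<And>z. 0 \<le> \<kappa> z" "\<And>z. \<kappa> z \<le> 1" "\<And>z. z \<notin> K \<Longrightarrow> \<kappa> z = 0" "(\<integral>\<omega>. \<kappa> (Z \<omega>) \<partial>P) > 1 - \<epsilon>"
    using compact_cutoff[OF P Z G \<open>\<epsilon> > 0\<close>] by metis
  have b: "\<bar>\<kappa> x\<bar> \<le> 1" for x using K(4,5)[of x] by auto
  have "\<forall>\<^sub>F T in F. (\<integral>\<omega>. \<kappa> (ZT T \<omega>) \<partial>P) > 1 - \<epsilon>"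
    using conv_distr_integral[OF conv K(3) b] K(7) by (rule order_tendstoD(1))
  with ZT have "\<forall>\<^sub>F T in F. \<exists>B\<in>sets P. measure P B \<le> \<epsilon> \<and> (\<forall>\<omega>\<in>space P - B. ZT T \<omega> \<in> K)"
  proof eventually_elim
    case (elim T)
    define A where "A = ZT T -` K \<inter> space P"
    have A: "A \<in> sets P"
      unfolding A_def using elim(1) K(1) by (auto intro!: measurable_sets compact_imp_closed borel_closed)
    have "(\<integral>\<omega>. \<kappa> (ZT T \<omega>) \<partial>P) \<le> (\<integral>\<omega>. indicator A \<omega> \<partial>P)"
    proof (rule integral_mono)
      show "integrable P (indicator A :: _ \<Rightarrow> real)"
        using A by (simp add: integrable_indicator_iff emeasure_eq_measure)
      show "integrable P (\<lambda>\<omega>. \<kappa> (ZT T \<omega>))"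
        by (rule integrable_continuous_bounded_comp[OF P K(3) b elim(1)])
      show "\<kappa> (ZT T \<omega>) \<le> indicator A \<omega>" if "\<omega> \<in> space P" for \<omega>
        using K(5,6) that by (auto simp: A_def indicator_def)
    qed
    then have "prob A \<ge> 1 - \<epsilon>" using elim(2) A by simp
    then have "prob (space P - A) \<le> \<epsilon>" using A by (simp add: prob_compl)
    then show ?case
      using A by (intro bexI[of _ "space P - A"]) (auto simp: A_def)
  qed
  with K(1,2) show ?thesis by blast
qed

text \<open>The point \<open>y\<close> may leave \<open>K\<close>, so uniform continuity is taken on
  the closed 1-neighbourhood of \<open>K\<close>, which is compact as a sum of compact sets.\<close>

lemma compact_uniform_continuity_nbhd:
  fixes f :: "'c::euclidean_space \<Rightarrow> real"
  assumes "compact K" "continuous_on UNIV f" "\<eta> > 0"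
  obtains e where "e > 0" "\<And>x y. x \<in> K \<Longrightarrow> dist y x \<le> e \<Longrightarrow> \<bar>f y - f x\<bar> \<le> \<eta>"
proof -
  define K' where "K' = {x + y |x y. x \<in> K \<and> y \<in> cball (0::'c) 1}"
  have "compact K'" unfolding K'_def by (intro compact_sums assms compact_cball)
  then have "uniformly_continuous_on K' f"
    using assms(2) by (intro compact_uniformly_continuous) (auto intro: continuous_on_subset)
  then obtain d where d: "d > 0" "\<And>x y. x \<in> K' \<Longrightarrow> y \<in> K' \<Longrightarrow> dist y x < d \<Longrightarrow> dist (f y) (f x) < \<eta>"
    using \<open>\<eta> > 0\<close> unfolding uniformly_continuous_on_def by metis
  \<comment> \<open>The bound 1 keeps \<open>y\<close> in \<open>K'\<close>; halving
    \<open>d\<close> turns the weak inequality into the strict one required.\<close>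
  have "\<bar>f y - f x\<bar> \<le> \<eta>" if "x \<in> K" "dist y x \<le> min 1 (d/2)" for x y
  proof -
    have *: "x + h \<in> K'" if "norm h \<le> 1" for h
      unfolding K'_def using \<open>x \<in> K\<close> that by auto
    have "x \<in> K'" "y \<in> K'"
      using *[of 0] *[of "y - x"] that by (auto simp: dist_norm)
    then have "dist (f y) (f x) < \<eta>"
      using d that by auto
    then show ?thesis by (simp add: dist_real_def)
  qed
  then show ?thesis using d(1) that[of "min 1 (d/2)"] by auto
qed

text \<open>Continuous mapping and Slutsky in one: \<open>g\<close> is continuous only on
  \<open>G\<close>, and \<open>V T\<close> is close to \<open>g (ZT T)\<close> only while
  \<open>ZT T\<close> stays in a compact part of \<open>G\<close>. Both \<open>f (V T)\<close> and
  \<open>f (g Z)\<close> are compared with one truncated test function, evaluated at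
  \<open>ZT T\<close> and at \<open>Z\<close>.\<close>

lemma conv_distr_continuous_mapping_approx:
  fixes G :: "'b::euclidean_space set" and g :: "'b \<Rightarrow> 'c::euclidean_space"
  assumes P: "prob_space P" and conv: "conv_distr P F ZT Z"
    and ZT: "\<forall>\<^sub>F T in F. ZT T \<in> borel_measurable P" and Z: "Z \<in> borel_measurable P"
    and V: "\<forall>\<^sub>F T in F. V T \<in> borel_measurable P"
    and G: "open G" "AE \<omega> in P. Z \<omega> \<in> G"
    and g: "continuous_on G g" and gZ: "(\<lambda>\<omega>. g (Z \<omega>)) \<in> borel_measurable P"
    and near: "\<And>K e. compact K \<Longrightarrow> K \<subseteq> G \<Longrightarrow> e > 0 \<Longrightarrow>
      whp P F (\<lambda>T \<omega>. ZT T \<omega> \<in> K \<longrightarrow> dist (V T \<omega>) (g (ZT T \<omega>)) \<le> e)"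
  shows "conv_distr P F V (\<lambda>\<omega>. g (Z \<omega>))"
  unfolding conv_distr_def
proof (intro allI impI tendstoI)
  interpret prob_space P by fact
  fix f :: "'c \<Rightarrow> real" and d :: real
  assume f: "continuous_on UNIV f \<and> bounded (range f)" and "d > 0"
  then obtain C where C: "C > 0" "\<And>x. \<bar>f x\<bar> \<le> C"
    by (auto simp: bounded_pos)
  \<comment> \<open>The three errors below add up to at most
    \<open>(2 + 4 * C) * \<epsilon>\<close>, which this choice keeps below \<open>d\<close>.\<close>
  define \<epsilon> where "\<epsilon> = d / (6 * (C + 1))"
  have \<epsilon>: "\<epsilon> > 0" unfolding \<epsilon>_def using \<open>d > 0\<close> C by simp
  obtain K and \<kappa> :: "'b \<Rightarrow> real" where K: "compact K" "K \<subseteq> G" "continuous_on UNIV \<kappa>"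
    "\<And>z. 0 \<le> \<kappa> z" "\<And>z. \<kappa> z \<le> 1" "\<And>z. z \<notin> K \<Longrightarrow> \<kappa> z = 0" "(\<integral>\<omega>. \<kappa> (Z \<omega>) \<partial>P) > 1 - \<epsilon>"
    using compact_cutoff[OF P Z G \<epsilon>] by metis
  have b: "\<bar>\<kappa> x\<bar> \<le> 1" for x using K(4,5)[of x] by auto
  \<comment> \<open>Multiplying by \<kappa> makes the composition continuous everywhere:
    \<open>G\<close> and the complement of \<open>K\<close> are open and cover the space, and the
    product vanishes on the latter.\<close>
  define \<phi> where "\<phi> z = f (g z) * \<kappa> z" for z
  have \<phi>_cont: "continuous_on UNIV \<phi>"
  proof -
    have "continuous_on G \<phi>"
      unfolding \<phi>_def using f K(3)
      by (intro continuous_on_mult continuous_on_compose2[OF _ g]) (auto intro: continuous_on_subset)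
    moreover have "continuous_on (- K) \<phi>"
      by (rule continuous_on_eq[of _ "\<lambda>_. 0"]) (auto simp: \<phi>_def K(6))
    moreover have "G \<union> - K = UNIV" using K(2) by auto
    ultimately show ?thesis
      using continuous_on_open_Un[of G "- K" \<phi>] G(1) compact_imp_closed[OF K(1)]
      by (simp add: open_Compl)
  qed
  have \<phi>_bound: "\<bar>\<phi> x\<bar> \<le> C" for x
    unfolding \<phi>_def using mult_mono[OF C(2)[of "g x"] b[of x]] C(1) by (simp add: abs_mult)
  obtain e where e: "e > 0" "\<And>x y. x \<in> g ` K \<Longrightarrow> dist y x \<le> e \<Longrightarrow> \<bar>f y - f x\<bar> \<le> \<epsilon>"
  proof (rule compact_uniform_continuity_nbhd)
    show "compact (g ` K)"
      using K(1,2) g by (intro compact_continuous_image) (auto intro: continuous_on_subset)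
  qed (use f \<epsilon> that in auto)
  \<comment> \<open>The truncation error is charged to \<open>1 - \<kappa> z\<close>, whose
    expectation is below \<epsilon> at the limit and eventually before it.\<close>
  have pt: "\<bar>f v - \<phi> z\<bar> \<le> \<epsilon> + C * (1 - \<kappa> z)" if "z \<in> K \<longrightarrow> dist v (g z) \<le> e" for v z
  proof (cases "z \<in> K")
    case True
    have "f v - \<phi> z = (f v - f (g z)) * \<kappa> z + f v * (1 - \<kappa> z)"
      by (simp add: \<phi>_def algebra_simps)
    also have "\<bar>\<dots>\<bar> \<le> \<bar>f v - f (g z)\<bar> * \<kappa> z + \<bar>f v\<bar> * (1 - \<kappa> z)"
      using abs_triangle_ineq[of "(f v - f (g z)) * \<kappa> z" "f v * (1 - \<kappa> z)"] K(4,5)[of z]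
      by (simp add: abs_mult)
    also have "\<dots> \<le> \<epsilon> * 1 + C * (1 - \<kappa> z)"
      using e(2)[of "g z" v] that True K(4,5) C \<epsilon> by (intro add_mono mult_mono) auto
    finally show ?thesis by simp
  next
    case False
    then show ?thesis using K(6) C(2)[of v] \<epsilon> by (simp add: \<phi>_def)
  qed
  have limit: "\<bar>(\<integral>\<omega>. \<phi> (Z \<omega>) \<partial>P) - (\<integral>\<omega>. f (g (Z \<omega>)) \<partial>P)\<bar> \<le> C * \<epsilon>"
  proof -
    have i1: "integrable P (\<lambda>\<omega>. \<phi> (Z \<omega>))"
      by (rule integrable_continuous_bounded_comp[OF P \<phi>_cont \<phi>_bound Z])
    have i2: "integrable P (\<lambda>\<omega>. f (g (Z \<omega>)))"
      by (rule integrable_continuous_bounded_comp[OF P _ C(2) gZ]) (use f in simp)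
    have i3: "integrable P (\<lambda>\<omega>. \<kappa> (Z \<omega>))"
      by (rule integrable_continuous_bounded_comp[OF P K(3) b Z])
    have "\<bar>(\<integral>\<omega>. \<phi> (Z \<omega>) - f (g (Z \<omega>)) \<partial>P)\<bar> \<le> (\<integral>\<omega>. \<bar>\<phi> (Z \<omega>) - f (g (Z \<omega>))\<bar> \<partial>P)"
      by (rule integral_abs_bound)
    also have "\<dots> \<le> (\<integral>\<omega>. C * (1 - \<kappa> (Z \<omega>)) \<partial>P)"
    proof (rule integral_mono)
      show "integrable P (\<lambda>\<omega>. C * (1 - \<kappa> (Z \<omega>)))" using i3 by auto
      show "\<bar>\<phi> (Z \<omega>) - f (g (Z \<omega>))\<bar> \<le> C * (1 - \<kappa> (Z \<omega>))" for \<omega>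
      proof -
        have "\<bar>\<phi> (Z \<omega>) - f (g (Z \<omega>))\<bar> = \<bar>f (g (Z \<omega>))\<bar> * (1 - \<kappa> (Z \<omega>))"
        proof -
          have "\<phi> (Z \<omega>) - f (g (Z \<omega>)) = - (f (g (Z \<omega>)) * (1 - \<kappa> (Z \<omega>)))"
            by (simp add: \<phi>_def algebra_simps)
          then show ?thesis using K(5)[of "Z \<omega>"] by (simp add: abs_mult)
        qed
        then show ?thesis using C K(5)[of "Z \<omega>"] by (simp add: mult_right_mono)
      qed
    qed (use i1 i2 in auto)
    also have "\<dots> = C * (1 - (\<integral>\<omega>. \<kappa> (Z \<omega>) \<partial>P))"
      using i3 by (simp add: prob_space)
    also have "\<dots> \<le> C * \<epsilon>" using K(7) C(1) by (intro mult_left_mono) auto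
    finally show ?thesis using i1 i2 by simp
  qed
  have ev1: "\<forall>\<^sub>F T in F. (\<integral>\<omega>. \<kappa> (ZT T \<omega>) \<partial>P) > 1 - \<epsilon>"
    using conv_distr_integral[OF conv K(3) b] K(7) by (rule order_tendstoD(1))
  have ev2: "\<forall>\<^sub>F T in F. dist (\<integral>\<omega>. \<phi> (ZT T \<omega>) \<partial>P) (\<integral>\<omega>. \<phi> (Z \<omega>) \<partial>P) < \<epsilon>"
    using conv_distr_integral[OF conv \<phi>_cont \<phi>_bound] \<epsilon> by (rule tendstoD)
  have ev3: "\<forall>\<^sub>F T in F. \<exists>B\<in>sets P. measure P B \<le> \<epsilon> \<and>
      (\<forall>\<omega>\<in>space P - B. ZT T \<omega> \<in> K \<longrightarrow> dist (V T \<omega>) (g (ZT T \<omega>)) \<le> e)"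
    using near[OF K(1,2) e(1)] \<epsilon> by (auto simp: whp_def)
  from ZT V ev1 ev2 ev3
  show "\<forall>\<^sub>F T in F. dist (\<integral>\<omega>. f (V T \<omega>) \<partial>P) (\<integral>\<omega>. f (g (Z \<omega>)) \<partial>P) < d"
  proof eventually_elim
    case (elim T)
    then obtain B where B: "B \<in> sets P" "prob B \<le> \<epsilon>"
      "\<forall>\<omega>\<in>space P - B. ZT T \<omega> \<in> K \<longrightarrow> dist (V T \<omega>) (g (ZT T \<omega>)) \<le> e" by blast
    have i1: "integrable P (\<lambda>\<omega>. \<phi> (ZT T \<omega>))"
      by (rule integrable_continuous_bounded_comp[OF P \<phi>_cont \<phi>_bound elim(1)])
    have i2: "integrable P (\<lambda>\<omega>. f (V T \<omega>))"
      by (rule integrable_continuous_bounded_comp[OF P _ C(2) elim(2)]) (use f in simp)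
    have i3: "integrable P (\<lambda>\<omega>. \<kappa> (ZT T \<omega>))"
      by (rule integrable_continuous_bounded_comp[OF P K(3) b elim(1)])
    have i4: "integrable P (indicator B :: _ \<Rightarrow> real)"
      using B by (simp add: integrable_indicator_iff emeasure_eq_measure)
    have "\<bar>(\<integral>\<omega>. f (V T \<omega>) - \<phi> (ZT T \<omega>) \<partial>P)\<bar> \<le> (\<integral>\<omega>. \<bar>f (V T \<omega>) - \<phi> (ZT T \<omega>)\<bar> \<partial>P)"
      by (rule integral_abs_bound)
    \<comment> \<open>On the exceptional set \<open>B\<close> only the trivial bound
      \<open>2 * C\<close> is available, hence the indicator term.\<close>
    also have "\<dots> \<le> (\<integral>\<omega>. (\<epsilon> + C * (1 - \<kappa> (ZT T \<omega>))) + 2 * C * indicator B \<omega> \<partial>P)"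
    proof (rule integral_mono)
      show "integrable P (\<lambda>\<omega>. (\<epsilon> + C * (1 - \<kappa> (ZT T \<omega>))) + 2 * C * indicator B \<omega>)"
        using i3 i4 by auto
      show "\<bar>f (V T \<omega>) - \<phi> (ZT T \<omega>)\<bar> \<le> (\<epsilon> + C * (1 - \<kappa> (ZT T \<omega>))) + 2 * C * indicator B \<omega>"
        if "\<omega> \<in> space P" for \<omega>
      proof (cases "\<omega> \<in> B")
        case True
        have "C * (1 - \<kappa> (ZT T \<omega>)) \<ge> 0" using C(1) K(5) by simp
        with True C(2)[of "V T \<omega>"] \<phi>_bound[of "ZT T \<omega>"] \<epsilon> show ?thesis by simp
      next
        case False
        with pt B(3) that show ?thesis by simp
      qed
    qed (use i1 i2 in auto)
    also have "\<dots> = \<epsilon> + C * (1 - (\<integral>\<omega>. \<kappa> (ZT T \<omega>) \<partial>P)) + 2 * C * prob B"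
      using i3 i4 B(1) by (simp add: prob_space algebra_simps)
    also have "\<dots> \<le> \<epsilon> + C * \<epsilon> + 2 * C * \<epsilon>"
      using elim(3) B(2) C(1) by (intro add_mono mult_left_mono) auto
    finally have "\<bar>(\<integral>\<omega>. f (V T \<omega>) \<partial>P) - (\<integral>\<omega>. \<phi> (ZT T \<omega>) \<partial>P)\<bar> \<le> \<epsilon> + 3 * C * \<epsilon>"
      using i1 i2 by simp
    then have "dist (\<integral>\<omega>. f (V T \<omega>) \<partial>P) (\<integral>\<omega>. f (g (Z \<omega>)) \<partial>P) < 4 * (C + 1) * \<epsilon>"
      using elim(4) limit \<epsilon> by (simp add: dist_real_def algebra_simps)
    also have "\<dots> \<le> 6 * (C + 1) * \<epsilon>" using C(1) \<epsilon> by simp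
    also have "\<dots> = d" unfolding \<epsilon>_def using C(1) by (simp add: field_simps)
    finally show ?case .
  qed
qed

section \<open>Measurability, almost sure equality and tightness along the index set\<close>

lemma eventually_along: "(\<And>T. T \<in> TT \<Longrightarrow> Q T) \<Longrightarrow> eventually Q (along TT)"
  by (simp add: along_def eventually_inf_principal)

lemma borel_measurable_vec_nth:
  fixes f :: "'a \<Rightarrow> real^'n"
  assumes "f \<in> borel_measurable M"
  shows "(\<lambda>x. f x $ j) \<in> borel_measurable M"
proof -
  have "(\<lambda>v :: real^'n. v $ j) \<in> borel_measurable borel"
    by (intro borel_measurable_continuous_onI continuous_intros)
  from measurable_compose[OF assms this] show ?thesis .
qed

lemma borel_measurable_vec_lambda:
  fixes f :: "'n::finite \<Rightarrow> 'a \<Rightarrow> real"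
  assumes "\<And>j. f j \<in> borel_measurable M"
  shows "(\<lambda>x. \<chi> j. f j x) \<in> borel_measurable M"
  by (subst borel_measurable_euclidean_space) (auto simp: Basis_vec_def inner_axis assms)

text \<open>A strict lower bound on the supremum is witnessed at some point, and by continuity at a
  point of a countable dense subset, so the event is a countable union of measurable ones.\<close>

lemma sets_SUP_greater:
  fixes f :: "'a \<Rightarrow> 'b::{metric_space,second_countable_topology} \<Rightarrow> real"
  assumes S: "compact S" "S \<noteq> {}"
    and cont: "\<And>\<omega>. \<omega> \<in> space M \<Longrightarrow> continuous_on S (f \<omega>)"
    and meas: "\<And>u. u \<in> S \<Longrightarrow> (\<lambda>\<omega>. f \<omega> u) \<in> borel_measurable M"
  shows "{\<omega> \<in> space M. (SUP u\<in>S. f \<omega> u) > e} \<in> sets M"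
proof -
  obtain D where D: "countable D" "D \<subseteq> S" "S \<subseteq> closure D" using separable[of S] by blast
  then have clD: "closure D = S"
    using S(1) by (meson closure_minimal compact_imp_closed subset_antisym)
  have "(SUP u\<in>S. f \<omega> u) > e \<longleftrightarrow> (\<exists>u\<in>D. f \<omega> u > e)" if \<omega>: "\<omega> \<in> space M" for \<omega>
  proof -
    have "bdd_above (f \<omega> ` S)"
      using compact_continuous_image[OF cont[OF \<omega>] S(1)] by (simp add: compact_imp_bounded bounded_imp_bdd_above)
    then have "(SUP u\<in>S. f \<omega> u) > e \<longleftrightarrow> (\<exists>u\<in>S. f \<omega> u > e)"
      using S(2) by (simp add: less_cSUP_iff)
    moreover have "f \<omega> u \<le> e" if "\<forall>u\<in>D. f \<omega> u \<le> e" "u \<in> S" for u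
      using continuous_le_on_closure[of D "f \<omega>" u e] cont[OF \<omega>] that by (simp add: clD)
    ultimately show ?thesis using D(2) by (meson not_le subsetD)
  qed
  then have "{\<omega> \<in> space M. (SUP u\<in>S. f \<omega> u) > e} = (\<Union>u\<in>D. {\<omega> \<in> space M. f \<omega> u > e})"
    by blast
  also have "\<dots> \<in> sets M"
    using D(1,2) meas by (intro sets.countable_UN') (auto intro: borel_measurable_less)
  finally show ?thesis .
qed

lemma conv_distr_AE_cong:
  assumes "conv_distr P F X Y" "AE \<omega> in P. Y \<omega> = Y' \<omega>"
    "Y \<in> borel_measurable P" "Y' \<in> borel_measurable P"
  shows "conv_distr P F X Y'"
  unfolding conv_distr_def
proof (intro allI impI)
  fix f :: "'b \<Rightarrow> real" assume f: "continuous_on UNIV f \<and> bounded (range f)"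
  then have fm: "f \<in> borel_measurable borel" by (simp add: borel_measurable_continuous_onI)
  have "(\<integral>\<omega>. f (Y \<omega>) \<partial>P) = (\<integral>\<omega>. f (Y' \<omega>) \<partial>P)"
    by (rule integral_cong_AE) (use assms(2) in \<open>auto intro!: measurable_compose[OF _ fm] assms\<close>)
  moreover have "((\<lambda>T. \<integral>\<omega>. f (X T \<omega>) \<partial>P) \<longlongrightarrow> (\<integral>\<omega>. f (Y \<omega>) \<partial>P)) F"
    using assms(1) f unfolding conv_distr_def by blast
  ultimately show "((\<lambda>T. \<integral>\<omega>. f (X T \<omega>) \<partial>P) \<longlongrightarrow> (\<integral>\<omega>. f (Y' \<omega>) \<partial>P)) F"
    by simp
qed

lemma tight_family_eventually:
  assumes "tight_family P TT X" "\<And>T. T \<in> TT \<Longrightarrow> X T \<in> borel_measurable P" "\<epsilon> > 0"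
  shows "\<exists>R. \<forall>\<^sub>F T in along TT. \<exists>B\<in>sets P. measure P B \<le> \<epsilon> \<and> (\<forall>\<omega>\<in>space P - B. norm (X T \<omega>) \<le> R)"
proof -
  obtain R where R: "\<forall>T\<in>TT. measure P {\<omega> \<in> space P. norm (X T \<omega>) > R} \<le> \<epsilon>"
    using assms(1,3) unfolding tight_family_def by blast
  have "\<exists>B\<in>sets P. measure P B \<le> \<epsilon> \<and> (\<forall>\<omega>\<in>space P - B. norm (X T \<omega>) \<le> R)" if "T \<in> TT" for T
  proof (intro bexI[of _ "{\<omega> \<in> space P. norm (X T \<omega>) > R}"] conjI)
    show "{\<omega> \<in> space P. norm (X T \<omega>) > R} \<in> sets P"
      using assms(2)[OF that] by (intro borel_measurable_less) auto
  qed (use R that in auto)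
  then show ?thesis by (intro exI[of _ R] eventually_along)
qed

section \<open>Block inverses and quadratic forms\<close>

definition block_id :: "'n set \<Rightarrow> real^'n^'n \<Rightarrow> real^'n^'n" where
  "block_id J M = (\<chi> i j. if i \<in> J \<and> j \<in> J then M $ i $ j else if i = j then 1 else 0)"

text \<open>Only the limit matrix is known to be symmetric, whereas the prelimit matrices enter through
  their quadratic forms alone, hence through their symmetric parts.\<close>

definition sym_part :: "real^'n^'n \<Rightarrow> real^'n^'n" where
  "sym_part M = (\<chi> i j. (M $ i $ j + M $ j $ i) / 2)"

lemma sub_inv_eq: "sub_inv J M = matrix_inv (block_id J M)"
  by (simp add: sub_inv_def block_id_def)

lemma sub_vec_nth [simp]: "sub_vec J x $ j = (if j \<in> J then x $ j else 0)"
  by (simp add: sub_vec_def)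

lemma diag_mat_mult_nth [simp]: "(diag_mat v *v u) $ j = v $ j * u $ j"
  by (simp add: matrix_vector_mult_def diag_mat_def if_distrib[where f="\<lambda>x. x * _"] sum.delta cong: if_cong)

lemma sym_part_symmetric: "transpose M = M \<Longrightarrow> sym_part M = M"
  by (simp add: sym_part_def transpose_def vec_eq_iff)

text \<open>For \<open>y = x\<close> the two quadratic forms agree, so positivity passes to the
  symmetric part; in general the right-hand side is half the cross term in the expansion of a
  quadratic form.\<close>

lemma inner_sym_part:
  "x \<bullet> (sym_part M *v y) = (x \<bullet> (M *v y) + y \<bullet> (M *v x)) / 2"
proof -
  have "y \<bullet> (M *v x) = x \<bullet> (transpose M *v y)"
    by (simp add: dot_lmul_matrix inner_commute flip: matrix_vector_mul_assoc)
       (metis dot_lmul_matrix inner_commute transpose_matrix_vector)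
  moreover have "sym_part M *v y = (1/2) *\<^sub>R (M *v y + transpose M *v y)"
    by (simp add: vec_eq_iff sym_part_def matrix_vector_mult_def transpose_def
        sum.distrib[symmetric] sum_divide_distrib algebra_simps add_divide_distrib)
  ultimately show ?thesis by (simp add: inner_add_right)
qed

lemma matrix_inv_mult_unique:
  fixes M :: "real^'n^'n"
  assumes "det M \<noteq> 0" "M *v x = b"
  shows "matrix_inv M *v b = x"
proof -
  have "\<exists>A'. M ** A' = mat 1 \<and> A' ** M = mat 1"
    using assms(1) by (simp add: invertible_det_nz[symmetric] invertible_def)
  then have "matrix_inv M ** M = mat 1"
    unfolding matrix_inv_def by (rule someI2_ex) simp
  then show ?thesis
    by (simp add: assms(2)[symmetric] matrix_vector_mul_assoc)
qed

text \<open>On singular matrices \<^const>\<open>matrix_inv\<close> is the constant junk value \<^term>\<open>SOME A. False\<close>, which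
  keeps it Borel measurable.\<close>

lemma matrix_inv_mult_eq_cramer:
  fixes M :: "real^'n^'n"
  shows "matrix_inv M *v b =
    (if det M = 0 then (SOME A. False) *v b
     else (\<chi> k. det (\<chi> i j. if j = k then b $ i else M $ i $ j) / det M))"
proof (cases "det M = 0")
  case True
  then have "\<not> invertible M" by (simp add: invertible_det_nz)
  then have "(\<lambda>A'. M ** A' = mat 1 \<and> A' ** M = mat 1) = (\<lambda>A. False)"
    by (auto simp: invertible_def fun_eq_iff)
  then have "matrix_inv M = (SOME A. False)"
    by (simp only: matrix_inv_def)
  with True show ?thesis by simp
next
  case False
  then show ?thesis using matrix_inv_mult_unique[OF False] cramer[OF False] by auto
qed

lemma continuous_on_det [continuous_intros]:
  fixes f :: "'b::topological_space \<Rightarrow> real^'n^'n"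
  assumes "continuous_on S f"
  shows "continuous_on S (\<lambda>x. det (f x))"
  unfolding det_def by (intro continuous_intros assms)

lemma continuous_on_matrix_vector_mult [continuous_intros]:
  fixes f :: "'b::topological_space \<Rightarrow> real^'n^'m"
  assumes "continuous_on S f" "continuous_on S g"
  shows "continuous_on S (\<lambda>x. f x *v g x)"
  unfolding matrix_vector_mult_def by (intro continuous_intros assms)

lemma continuous_on_block_id [continuous_intros]:
  assumes "continuous_on S f"
  shows "continuous_on S (\<lambda>x. block_id J (f x))"
  unfolding block_id_def
proof (intro continuous_on_vec_lambda)
  fix i j
  show "continuous_on S (\<lambda>x. if i \<in> J \<and> j \<in> J then f x $ i $ j else if i = j then 1 else 0)"
    by (cases "i \<in> J \<and> j \<in> J") (auto intro!: continuous_intros assms)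
qed

lemma continuous_on_sym_part [continuous_intros]:
  assumes "continuous_on S f"
  shows "continuous_on S (\<lambda>x. sym_part (f x))"
  unfolding sym_part_def by (intro continuous_intros assms) auto

lemma continuous_on_sub_vec [continuous_intros]:
  assumes "continuous_on S f"
  shows "continuous_on S (\<lambda>x. sub_vec J (f x))"
  unfolding sub_vec_def
proof (intro continuous_on_vec_lambda)
  fix j
  show "continuous_on S (\<lambda>x. if j \<in> J then f x $ j else 0)"
    by (cases "j \<in> J") (auto intro!: continuous_intros assms)
qed

text \<open>Cramer's rule writes the solution as a vector of quotients of determinants with
  nonvanishing denominator.\<close>

lemma continuous_on_matrix_inv_mult:
  fixes M :: "'b::topological_space \<Rightarrow> real^'n^'n"
  assumes "continuous_on S M" "continuous_on S b" "\<And>x. x \<in> S \<Longrightarrow> det (M x) \<noteq> 0"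
  shows "continuous_on S (\<lambda>x. matrix_inv (M x) *v b x)"
proof -
  have *: "continuous_on S (\<lambda>x. if j = k then b x $ i else M x $ i $ j)" for i j k
    by (cases "j = k") (auto intro!: continuous_intros assms)
  have "continuous_on S (\<lambda>x. \<chi> k. det (\<chi> i j. if j = k then b x $ i else M x $ i $ j) / det (M x))"
    by (intro continuous_intros assms * ballI)
  then show ?thesis
    by (rule continuous_on_eq) (simp add: matrix_inv_mult_eq_cramer assms(3))
qed

text \<open>On the open set of nonzero determinant the map is continuous, and on its complement the
  inverse is one fixed matrix. Singular matrices have to be covered because the limit matrix is
  positive definite only almost surely.\<close>

lemma borel_measurable_matrix_inv_mult:
  fixes M :: "'b::topological_space \<Rightarrow> real^'n^'n"
  assumes "continuous_on UNIV M" "continuous_on UNIV b"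
  shows "(\<lambda>x. matrix_inv (M x) *v b x) \<in> borel_measurable borel"
proof -
  define A where "A = {x. det (M x) \<noteq> 0}"
  have "A = (\<lambda>x. det (M x)) -` (- {0})" by (auto simp: A_def)
  moreover have "open \<dots>"
    by (rule open_vimage) (auto intro!: continuous_intros assms)
  ultimately have A: "A \<in> sets borel" by simp
  have "continuous_on A (\<lambda>x. matrix_inv (M x) *v b x)"
    by (rule continuous_on_matrix_inv_mult) (auto simp: A_def intro: continuous_on_subset[OF assms(1)] continuous_on_subset[OF assms(2)])
  moreover have "continuous_on (- A) (\<lambda>x. (SOME A. False) *v b x)"
    by (intro continuous_intros continuous_on_subset[OF assms(2)]) auto
  ultimately have "(\<lambda>x. if x \<in> A then matrix_inv (M x) *v b x else (SOME A. False) *v b x) \<in> borel_measurable borel"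
    by (rule borel_measurable_continuous_on_if[OF A])
  moreover have "(\<lambda>x. if x \<in> A then matrix_inv (M x) *v b x else (SOME A. False) *v b x)
      = (\<lambda>x. matrix_inv (M x) *v b x)"
    by (auto simp: A_def matrix_inv_mult_eq_cramer)
  ultimately show ?thesis by simp
qed

text \<open>By homogeneity it suffices to test unit vectors. The complement is then the projection
  of a closed set along the compact sphere, hence closed.\<close>

lemma open_positive_quadratic_form:
  "open {M :: real^'n^'n. \<forall>x. x \<noteq> 0 \<longrightarrow> x \<bullet> (M *v x) > 0}"
proof -
  have "closed {p :: (real^'n) \<times> (real^'n^'n). fst p \<bullet> (snd p *v fst p) \<le> 0}"
    by (intro closed_Collect_le continuous_intros)
  then have "closed {M. \<exists>x. x \<in> sphere 0 1 \<and> (x, M) \<in> {p :: (real^'n) \<times> (real^'n^'n). fst p \<bullet> (snd p *v fst p) \<le> 0}}"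
    by (intro closed_compact_projection) auto
  moreover have "{M :: real^'n^'n. \<forall>x. x \<noteq> 0 \<longrightarrow> x \<bullet> (M *v x) > 0} =
      - {M. \<exists>x. x \<in> sphere 0 1 \<and> (x, M) \<in> {p :: (real^'n) \<times> (real^'n^'n). fst p \<bullet> (snd p *v fst p) \<le> 0}}"
    (is "?A = - ?B")
  proof (intro set_eqI iffI)
    fix M assume "M \<in> ?A"
    then have "x \<bullet> (M *v x) > 0" if "norm x = 1" for x
      using that by (metis (mono_tags, lifting) mem_Collect_eq norm_zero zero_neq_one)
    then show "M \<in> - ?B" by (force simp: not_le)
  next
    fix M assume M: "M \<in> - ?B"
    show "M \<in> ?A"
    proof safe
      fix x :: "real^'n" assume "x \<noteq> 0"
      then have "sgn x \<in> sphere 0 1" by (simp add: norm_sgn)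
      with M have "sgn x \<bullet> (M *v sgn x) > 0" by (auto simp: not_le)
      then have "inverse (norm x) * (inverse (norm x) * (x \<bullet> (M *v x))) > 0"
        by (simp add: sgn_div_norm matrix_vector_mult_scaleR)
      then show "x \<bullet> (M *v x) > 0"
        using \<open>x \<noteq> 0\<close> by (simp add: zero_less_mult_iff)
    qed
  qed
  ultimately show ?thesis by (simp add: open_Compl)
qed

lemma block_id_mult_nth:
  "(block_id J M *v x) $ i = (if i \<in> J then (M *v sub_vec J x) $ i else x $ i)"
proof (cases "i \<in> J")
  case True
  then show ?thesis
    by (auto simp: block_id_def matrix_vector_mult_def intro!: sum.cong)
next
  case False
  have "(\<Sum>j\<in>UNIV. (if i = j then 1 else 0) * x $ j) = (\<Sum>j\<in>UNIV. if i = j then x $ j else 0)"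
    by (intro sum.cong) auto
  with False show ?thesis
    by (simp add: block_id_def matrix_vector_mult_def sum.delta')
qed

text \<open>The identity block forces a kernel vector to be supported on \<open>J\<close>; on such a
  vector the quadratic form of \<open>M\<close> vanishes, so the vector is 0.\<close>

lemma det_block_id_nonzero:
  assumes M: "\<And>x. x \<noteq> 0 \<Longrightarrow> x \<bullet> (M *v x) > 0"
  shows "det (block_id J M) \<noteq> 0"
proof -
  have "x = 0" if "block_id J M *v x = 0" for x
  proof (rule ccontr)
    assume "x \<noteq> 0"
    have *: "(if i \<in> J then (M *v sub_vec J x) $ i else x $ i) = 0" for i
      using that by (metis block_id_mult_nth zero_index)
    then have "x $ i = 0" if "i \<notin> J" for i using that by (metis (full_types))
    then have x: "sub_vec J x = x" by (auto simp: vec_eq_iff)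
    have "x \<bullet> (M *v x) = (\<Sum>i\<in>UNIV. x $ i * (M *v x) $ i)" by (simp add: inner_vec_def)
    also have "\<dots> = 0"
    proof (intro sum.neutral ballI)
      show "x $ i * (M *v x) $ i = 0" for i
        using *[of i] by (cases "i \<in> J") (simp_all add: x)
    qed
    finally show False using M[OF \<open>x \<noteq> 0\<close>] by simp
  qed
  then have "invertible (block_id J M)"
    by (simp add: invertible_left_inverse matrix_left_invertible_ker)
  then show ?thesis by (simp add: invertible_det_nz)
qed

text \<open>Passes from the weak form of the linear system to its solution: testing with the unit
  vectors of \<open>J\<close> recovers the equation coordinatewise, and off \<open>J\<close> the
  identity block gives 0 on both sides.\<close>

lemma sub_inv_mult_solution:
  assumes M: "\<And>x. x \<noteq> 0 \<Longrightarrow> x \<bullet> (M *v x) > 0"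
    and u: "\<And>j. j \<notin> J \<Longrightarrow> u $ j = 0"
    and eq: "\<And>d. (\<And>j. j \<notin> J \<Longrightarrow> d $ j = 0) \<Longrightarrow> b \<bullet> d = d \<bullet> (M *v u)"
  shows "sub_inv J M *v sub_vec J b = u"
  unfolding sub_inv_eq
proof (rule matrix_inv_mult_unique[OF det_block_id_nonzero[OF M]])
  have u': "sub_vec J u = u" using u by (auto simp: vec_eq_iff)
  have "b $ j = (M *v u) $ j" if "j \<in> J" for j
  proof -
    have "b \<bullet> axis j 1 = axis j 1 \<bullet> (M *v u)"
      by (rule eq) (use that in \<open>auto simp: axis_def\<close>)
    then show ?thesis by (simp add: inner_axis inner_axis')
  qed
  then show "block_id J M *v u = sub_vec J b"
    by (auto simp: vec_eq_iff block_id_mult_nth u' u)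
qed auto

lemma abs_diag_mat_nth_le_onorm: "\<bar>v $ j\<bar> \<le> onorm (\<lambda>u. diag_mat v *v u)"
proof -
  have "\<bar>v $ j\<bar> = \<bar>(diag_mat v *v axis j 1) $ j\<bar>" by (simp add: axis_def)
  also have "\<dots> \<le> norm (diag_mat v *v axis j 1)" by (rule component_le_norm_cart)
  also have "\<dots> \<le> onorm (\<lambda>u. diag_mat v *v u) * norm (axis j 1 :: real^'a)"
    by (rule onorm) (rule matrix_vector_mul_bounded_linear)
  finally show ?thesis by (simp add: norm_axis_1)
qed

lemma invertible_diag_mat_nth:
  fixes v :: "real^'n"
  assumes "invertible (diag_mat v)"
  shows "v $ j \<noteq> 0"
proof
  assume "v $ j = 0"
  then have "diag_mat v *v axis j 1 = diag_mat v *v 0"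
    by (simp add: vec_eq_iff axis_def)
  then have "axis j 1 = (0 :: real^'n)"
    using inj_matrix_vector_mult[OF assms] by (blast dest: injD)
  then show False by (simp add: axis_eq_0_iff)
qed

section \<open>The limit of penalised maximisers\<close>

text \<open>For small \<open>t\<close> the linear term dominates the quadratic one, so a nonzero
  \<open>A\<close> is refuted by a small \<open>t\<close> with the sign of \<open>A\<close>.\<close>

lemma linear_coeff_zero_of_quadratic_bound:
  fixes A B :: real
  assumes "\<tau> > 0" "\<And>t. \<bar>t\<bar> \<le> \<tau> \<Longrightarrow> t * A \<le> t\<^sup>2 * B"
  shows "A = 0"
proof (rule ccontr)
  assume "A \<noteq> 0"
  \<comment> \<open>Small enough that \<open>s * (\<bar>B\<bar> + 1)\<close> is at most half of
    \<open>\<bar>A\<bar>\<close>; adding 1 avoids a division by 0 when \<open>B\<close>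
    vanishes.\<close>
  define s where "s = min \<tau> (\<bar>A\<bar> / (2 * (\<bar>B\<bar> + 1)))"
  have s: "s > 0" "s \<le> \<tau>" "s \<le> \<bar>A\<bar> / (2 * (\<bar>B\<bar> + 1))"
    using assms(1) \<open>A \<noteq> 0\<close> by (auto simp: s_def)
  have "s * \<bar>A\<bar> = s * sgn A * A" by (simp add: abs_sgn algebra_simps)
  also have "\<dots> \<le> (s * sgn A)\<^sup>2 * B"
    using s by (intro assms(2)) (simp add: abs_mult abs_sgn_eq)
  also have "\<dots> \<le> s * (s * (\<bar>B\<bar> + 1))"
    using \<open>A \<noteq> 0\<close> s(1) by (simp add: power_mult_distrib sgn_if power2_eq_square mult_left_mono)
  finally have "\<bar>A\<bar> \<le> s * (\<bar>B\<bar> + 1)" using s(1) by simp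
  also have "\<dots> \<le> \<bar>A\<bar> / (2 * (\<bar>B\<bar> + 1)) * (\<bar>B\<bar> + 1)"
    using s(3) by (rule mult_right_mono) simp
  also have "\<dots> = \<bar>A\<bar> / 2"
  proof -
    have "a / (2 * k) * k = a / 2" if "k \<noteq> 0" for a k :: real using that by simp
    then show ?thesis by (metis abs_ge_zero add_nonneg_pos less_irrefl zero_less_one)
  qed
  finally show False using \<open>A \<noteq> 0\<close> by simp
qed

lemma tendsto_matrix_vector_mult [tendsto_intros]:
  fixes f :: "'b \<Rightarrow> real^'n^'m"
  assumes "(f \<longlongrightarrow> A) F" "(g \<longlongrightarrow> x) F"
  shows "((\<lambda>z. f z *v g z) \<longlongrightarrow> A *v x) F"
  unfolding matrix_vector_mult_def by (intro tendsto_intros assms)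

text \<open>Caratheodory's form of the derivative, with increments \<open>g z * (z - x)\<close> for
  some \<open>g\<close> continuous at \<open>x\<close>, avoids dividing by
  \<open>\<alpha> n * y n\<close>, which may be 0.\<close>

lemma tendsto_scaled_increment:
  fixes f :: "real \<Rightarrow> real"
  assumes "f differentiable (at x)" "\<alpha> \<longlonglongrightarrow> 0" "(\<lambda>n. \<xi> n * \<alpha> n) \<longlonglongrightarrow> b" "y \<longlonglongrightarrow> y0"
  shows "(\<lambda>n. \<xi> n * (f (x + \<alpha> n * y n) - f x)) \<longlonglongrightarrow> b * deriv f x * y0"
proof -
  have "DERIV f x :> deriv f x"
    using assms(1) by (simp add: DERIV_deriv_iff_real_differentiable)
  then obtain g where g: "\<And>z. f z - f x = g z * (z - x)" "isCont g x" "g x = deriv f x"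
    using CARAT_DERIV by blast
  have "(\<lambda>n. x + \<alpha> n * y n) \<longlonglongrightarrow> x + 0 * y0" by (intro tendsto_intros assms)
  then have "(\<lambda>n. g (x + \<alpha> n * y n)) \<longlonglongrightarrow> g x"
    using isCont_tendsto_compose[OF g(2)] by simp
  then have "(\<lambda>n. (\<xi> n * \<alpha> n) * g (x + \<alpha> n * y n) * y n) \<longlonglongrightarrow> b * g x * y0"
    by (intro tendsto_intros assms)
  then show ?thesis by (simp add: g algebra_simps)
qed

text \<open>The second claim is the first-order condition for the limiting quadratic criterion on the
  unpenalised coordinates.  Competitors at distance at most 1 suffice for it, so the remainder bound
  is needed only on the ball of radius \<open>R + 1\<close>.\<close>

lemma penalized_argmax_limit:
  fixes \<Theta> :: "(real^'p) set" and \<theta>s :: "real^'p" and \<alpha> \<xi> \<theta>h \<Delta> :: "nat \<Rightarrow> real^'p"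
    and \<Gamma> :: "nat \<Rightarrow> real^'p^'p" and H r :: "nat \<Rightarrow> real^'p \<Rightarrow> real"
  assumes Theta: "open \<Theta>" "\<theta>s \<in> \<Theta>"
    and xi_pos: "\<And>n j. \<xi> n $ j > 0" and al_nz: "\<And>n j. \<alpha> n $ j \<noteq> 0"
    and pen_nonneg: "\<And>x. pen x \<ge> 0" and pen0: "pen 0 = 0"
    and q: "0 < q"
    and A2: "\<And>x. x \<noteq> 0 \<Longrightarrow> pen differentiable (at x)"
    and A5: "((\<lambda>x. pen x / \<bar>x\<bar> powr q) \<longlongrightarrow> lam) (at 0)" "lam > 0"
    and th: "\<And>n. \<theta>h n \<in> closure \<Theta>"
    and th_max: "\<And>n \<theta>. \<theta> \<in> closure \<Theta> \<Longrightarrow> H n \<theta> - (\<Sum>j\<in>UNIV. \<xi> n $ j * pen (\<theta> $ j))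
           \<le> H n (\<theta>h n) - (\<Sum>j\<in>UNIV. \<xi> n $ j * pen (\<theta>h n $ j))"
    and laq: "\<And>n u. \<theta>s + diag_mat (\<alpha> n) *v u \<in> closure \<Theta> \<Longrightarrow>
        H n (\<theta>s + diag_mat (\<alpha> n) *v u) - H n \<theta>s
          = \<Delta> n \<bullet> u - (1/2) * (u \<bullet> (\<Gamma> n *v u)) + r n u"
    and rem: "\<And>n u. \<theta>s + diag_mat (\<alpha> n) *v u \<in> closure \<Theta> \<Longrightarrow> norm u \<le> R + 1 \<Longrightarrow> \<bar>r n u\<bar> \<le> \<rho> n"
    and rho: "\<rho> \<longlonglongrightarrow> 0"
    and al: "\<And>j. (\<lambda>n. \<alpha> n $ j) \<longlonglongrightarrow> 0"
    and A6: "\<And>j. \<theta>s $ j = 0 \<Longrightarrow> (\<lambda>n. (\<xi> n $ j) powr (-1/q) * inverse \<bar>\<alpha> n $ j\<bar>) \<longlonglongrightarrow> 0"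
    and A11: "\<And>j. \<theta>s $ j \<noteq> 0 \<Longrightarrow> (\<lambda>n. \<xi> n $ j * \<alpha> n $ j) \<longlonglongrightarrow> \<beta> $ j"
    and ut: "(\<lambda>n. \<chi> j. (\<theta>h n $ j - \<theta>s $ j) / (if \<theta>s $ j = 0 then (\<xi> n $ j) powr (-1/q) else \<alpha> n $ j))
         \<longlonglongrightarrow> u" and uR: "norm u \<le> R"
    and Del: "\<Delta> \<longlonglongrightarrow> D" and Gam: "\<Gamma> \<longlonglongrightarrow> G"
  shows "\<theta>s $ j = 0 \<Longrightarrow> u $ j = 0"
    and "(\<And>j. \<theta>s $ j = 0 \<Longrightarrow> d $ j = 0) \<Longrightarrow>
      (D - (\<chi> j. \<beta> $ j * deriv pen (\<theta>s $ j))) \<bullet> d = d \<bullet> (sym_part G *v u)"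
proof -
  define v where "v n = (\<chi> j. (\<theta>h n $ j - \<theta>s $ j) / (if \<theta>s $ j = 0 then (\<xi> n $ j) powr (-1/q) else \<alpha> n $ j))" for n
  \<comment> \<open>\<open>v\<close> is normalised at the rates of the claim, \<open>w\<close> at
    those of the quadratic expansion; they differ only where \<open>\<theta>s\<close> is 0.\<close>
  define w where "w n = (\<chi> j. (\<theta>h n $ j - \<theta>s $ j) / \<alpha> n $ j)" for n
  define v0 where "v0 = (\<chi> j. if \<theta>s $ j = 0 then 0 else u $ j)"
  define L where "L x = D \<bullet> x - (1/2) * (x \<bullet> (G *v x))" for x
  have v_lim: "v \<longlonglongrightarrow> u" using ut by (simp add: v_def[abs_def])
  have v_nth: "(\<lambda>n. v n $ j) \<longlonglongrightarrow> u $ j" for j by (intro tendsto_intros v_lim)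
  have xi_powr: "\<xi> n $ j powr (-1/q) > 0" for n j
    using xi_pos[of n j] by simp
  have w_nth: "(\<lambda>n. w n $ j) \<longlonglongrightarrow> v0 $ j" for j
  proof (cases "\<theta>s $ j = 0")
    case True
    \<comment> \<open>Up to sign, this coordinate of \<open>w\<close> is that of \<open>v\<close>
      times the ratio in [A6], and \<open>v\<close> converges.\<close>
    have "(\<lambda>n. v n $ j * (\<xi> n $ j powr (-1/q) * inverse \<bar>\<alpha> n $ j\<bar>)) \<longlonglongrightarrow> u $ j * 0"
      by (intro tendsto_intros v_nth A6 True)
    then have "(\<lambda>n. \<bar>v n $ j * (\<xi> n $ j powr (-1/q) * inverse \<bar>\<alpha> n $ j\<bar>)\<bar>) \<longlonglongrightarrow> 0"
      by (simp add: tendsto_rabs_zero_iff)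
    moreover have "\<bar>v n $ j * (\<xi> n $ j powr (-1/q) * inverse \<bar>\<alpha> n $ j\<bar>)\<bar> = \<bar>w n $ j\<bar>" for n
      using xi_powr[of n j] al_nz[of n j] True
      by (simp add: v_def w_def abs_mult divide_simps)
    ultimately have "(\<lambda>n. \<bar>w n $ j\<bar>) \<longlonglongrightarrow> 0" by simp
    then show ?thesis using True by (simp add: v0_def tendsto_rabs_zero_iff)
  next
    case False
    then show ?thesis using v_nth[of j] by (simp add: v_def w_def v0_def)
  qed
  then have w_lim: "w \<longlonglongrightarrow> v0" by (rule vec_tendstoI)
  have th_w: "\<theta>h n = \<theta>s + diag_mat (\<alpha> n) *v w n" for n
    using al_nz by (simp add: vec_eq_iff w_def)
  have "norm v0 \<le> norm u"
    by (rule norm_le_componentwise_cart) (simp add: v0_def)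
  \<comment> \<open>Strictness places \<open>w\<close>, and its truncation below, eventually inside
    the ball of radius \<open>R + 1\<close> where the remainder is controlled.\<close>
  then have v0R: "norm v0 < R + 1" using uR by simp

  \<comment> \<open>Convergence of the criterion along convergent arguments\<close>
  have ins: "(\<lambda>n. \<theta>s + diag_mat (\<alpha> n) *v x n) \<longlonglongrightarrow> \<theta>s" if "x \<longlonglongrightarrow> x0" for x x0
  proof (rule vec_tendstoI)
    fix j
    have "(\<lambda>n. \<theta>s $ j + \<alpha> n $ j * x n $ j) \<longlonglongrightarrow> \<theta>s $ j + 0 * x0 $ j"
      by (intro tendsto_intros al that)
    then show "(\<lambda>n. (\<theta>s + diag_mat (\<alpha> n) *v x n) $ j) \<longlonglongrightarrow> \<theta>s $ j" by simp
  qed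
  \<comment> \<open>\<open>\<theta>s\<close> is an interior point and the displacements vanish, so
    each such competitor is eventually admissible.\<close>
  have ev_in: "\<forall>\<^sub>F n in sequentially. \<theta>s + diag_mat (\<alpha> n) *v x n \<in> closure \<Theta>" if "x \<longlonglongrightarrow> x0" for x x0
    using topological_tendstoD[OF ins[OF that] Theta]
    by eventually_elim (use closure_subset in blast)
  have H_lim: "(\<lambda>n. H n (\<theta>s + diag_mat (\<alpha> n) *v x n) - H n \<theta>s) \<longlonglongrightarrow> L x0"
    if x: "x \<longlonglongrightarrow> x0" "\<forall>\<^sub>F n in sequentially. norm (x n) \<le> R + 1" for x x0
  proof -
    have "(\<lambda>n. r n (x n)) \<longlonglongrightarrow> 0"
    proof (rule Lim_null_comparison[OF _ rho])
      show "\<forall>\<^sub>F n in sequentially. norm (r n (x n)) \<le> \<rho> n"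
        using ev_in[OF x(1)] x(2) by eventually_elim (simp add: rem)
    qed
    then have "(\<lambda>n. \<Delta> n \<bullet> x n - (1/2) * (x n \<bullet> (\<Gamma> n *v x n)) + r n (x n)) \<longlonglongrightarrow> L x0 + 0"
      unfolding L_def by (intro tendsto_intros x(1) Del Gam)
    moreover have "\<forall>\<^sub>F n in sequentially. \<Delta> n \<bullet> x n - (1/2) * (x n \<bullet> (\<Gamma> n *v x n)) + r n (x n)
        = H n (\<theta>s + diag_mat (\<alpha> n) *v x n) - H n \<theta>s"
      using ev_in[OF x(1)] by eventually_elim (simp add: laq)
    ultimately show ?thesis by (simp add: tendsto_cong)
  qed
  have w_bound: "\<forall>\<^sub>F n in sequentially. norm (w n) \<le> R + 1"
    using order_tendstoD(2)[OF tendsto_norm[OF w_lim] v0R] by eventually_elim simp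
  have Hw: "(\<lambda>n. H n (\<theta>h n) - H n \<theta>s) \<longlonglongrightarrow> L v0"
    using H_lim[OF w_lim w_bound] by (simp add: th_w[symmetric])

  \<comment> \<open>Vanishing of the penalty on the zero coordinates\<close>
  define S where "S n = (\<Sum>j\<in>UNIV. if \<theta>s $ j = 0 then \<xi> n $ j * pen (\<theta>h n $ j) else 0)" for n
  have S_term: "0 \<le> (if \<theta>s $ j = 0 then \<xi> n $ j * pen (\<theta>h n $ j) else 0)" for n j
    using xi_pos[of n j] pen_nonneg by simp
  have S_lim: "S \<longlonglongrightarrow> 0"
  proof -
    \<comment> \<open>The competitor drops the coordinates where \<open>\<theta>s\<close> is 0. It
      has the same limit as \<open>w\<close>, so the gap in the unpenalised criterion tends to 0,
      and maximality bounds the penalty \<open>S\<close> by this gap.\<close>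
    define x where "x n = (\<chi> j. if \<theta>s $ j = 0 then 0 else w n $ j)" for n
    have x_lim: "x \<longlonglongrightarrow> v0"
    proof (rule vec_tendstoI)
      show "(\<lambda>n. x n $ j) \<longlonglongrightarrow> v0 $ j" for j
        using w_nth[of j] by (cases "\<theta>s $ j = 0") (simp_all add: x_def v0_def)
    qed
    have x_bound: "\<forall>\<^sub>F n in sequentially. norm (x n) \<le> R + 1"
      using order_tendstoD(2)[OF tendsto_norm[OF x_lim] v0R] by eventually_elim simp
    have "(\<lambda>n. (H n (\<theta>h n) - H n \<theta>s) - (H n (\<theta>s + diag_mat (\<alpha> n) *v x n) - H n \<theta>s)) \<longlonglongrightarrow> L v0 - L v0"
      by (intro tendsto_diff Hw H_lim x_lim x_bound)
    then have lim: "(\<lambda>n. H n (\<theta>h n) - H n (\<theta>s + diag_mat (\<alpha> n) *v x n)) \<longlonglongrightarrow> 0" by simp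
    have "\<forall>\<^sub>F n in sequentially. norm (S n) \<le> H n (\<theta>h n) - H n (\<theta>s + diag_mat (\<alpha> n) *v x n)"
      using ev_in[OF x_lim]
    proof eventually_elim
      case (elim n)
      have "(\<Sum>j\<in>UNIV. \<xi> n $ j * pen (\<theta>h n $ j))
          - (\<Sum>j\<in>UNIV. \<xi> n $ j * pen ((\<theta>s + diag_mat (\<alpha> n) *v x n) $ j)) = S n"
        unfolding S_def sum_subtractf[symmetric]
        by (rule sum.cong) (use al_nz in \<open>auto simp: x_def w_def pen0\<close>)
      moreover have "S n \<ge> 0" unfolding S_def by (rule sum_nonneg) (rule S_term)
      ultimately show ?case using th_max[OF elim, of n] by simp
    qed
    then show ?thesis using lim by (rule Lim_null_comparison)
  qed

  show u0: "u $ j = 0" if "\<theta>s $ j = 0" for j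
  proof -
    \<comment> \<open>[A5] bounds \<open>pen\<close> from below near 0 by \<open>lam / 2\<close>
      times the \<open>q\<close>-th power, so a vanishing penalty forces vanishing normalised
      coordinates.\<close>
    have "\<forall>\<^sub>F x in at 0. pen x / \<bar>x\<bar> powr q > lam / 2"
      using A5 by (intro order_tendstoD(1)) auto
    then obtain e where e: "e > 0" "\<And>x. x \<noteq> 0 \<Longrightarrow> \<bar>x\<bar> < e \<Longrightarrow> pen x / \<bar>x\<bar> powr q > lam / 2"
      by (auto simp: eventually_at dist_real_def)
    have pen_ge: "lam / 2 * \<bar>x\<bar> powr q \<le> pen x" if "\<bar>x\<bar> < e" for x
      using e(2)[of x] that by (cases "x = 0") (auto simp: pen0 field_simps)
    have "(\<lambda>n. \<theta>h n $ j) \<longlonglongrightarrow> 0"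
      using tendsto_vec_nth[OF ins[OF w_lim], of j] \<open>\<theta>s $ j = 0\<close> by (simp add: th_w)
    then have ev: "\<forall>\<^sub>F n in sequentially. \<bar>\<theta>h n $ j\<bar> < e"
      using e(1) by (auto dest: tendstoD simp: dist_real_def)
    have "\<forall>\<^sub>F n in sequentially. norm (\<bar>v n $ j\<bar> powr q) \<le> 2 / lam * S n"
      using ev
    proof eventually_elim
      case (elim n)
      have "\<theta>h n $ j = v n $ j * (\<xi> n $ j) powr (-1/q)"
        using \<open>\<theta>s $ j = 0\<close> xi_powr[of n j] by (simp add: v_def)
      then have "\<bar>\<theta>h n $ j\<bar> powr q = \<bar>v n $ j\<bar> powr q * (\<xi> n $ j) powr (-1)"
        using q by (simp add: abs_mult powr_mult powr_powr)
      \<comment> \<open>The normalisation is made for this identity: the weight times the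
        \<open>q\<close>-th power of the estimator is exactly the \<open>q\<close>-th power of
        \<open>v\<close>.\<close>
      then have "\<bar>v n $ j\<bar> powr q = \<xi> n $ j * \<bar>\<theta>h n $ j\<bar> powr q"
        using xi_pos[of n j] by (simp add: powr_minus)
      also have "lam / 2 * \<dots> \<le> \<xi> n $ j * pen (\<theta>h n $ j)"
        using mult_left_mono[OF pen_ge[OF elim], of "\<xi> n $ j"] xi_pos[of n j]
        by (simp add: algebra_simps)
      also have "\<dots> \<le> S n"
        unfolding S_def using member_le_sum[of j UNIV "\<lambda>j. if \<theta>s $ j = 0 then \<xi> n $ j * pen (\<theta>h n $ j) else 0"]
          S_term \<open>\<theta>s $ j = 0\<close> by simp
      finally show ?case using A5(2) by (simp add: field_simps)
    qed
    moreover have "(\<lambda>n. 2 / lam * S n) \<longlonglongrightarrow> 0"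
      using tendsto_mult[OF tendsto_const S_lim, of "2 / lam"] by simp
    ultimately have "(\<lambda>n. \<bar>v n $ j\<bar> powr q) \<longlonglongrightarrow> 0" by (rule Lim_null_comparison)
    moreover have "(\<lambda>n. \<bar>v n $ j\<bar> powr q) \<longlonglongrightarrow> \<bar>u $ j\<bar> powr q"
      using q by (intro tendsto_powr2 tendsto_intros v_nth) auto
    ultimately have "\<bar>u $ j\<bar> powr q = 0" using LIMSEQ_unique by blast
    then show ?thesis by simp
  qed
  then have v0: "v0 = u" by (auto simp: vec_eq_iff v0_def)

  \<comment> \<open>First-order condition on the nonzero coordinates\<close>
  define c where "c = (\<chi> j. \<beta> $ j * deriv pen (\<theta>s $ j))"
  \<comment> \<open>Penalty increments on the nonzero coordinates; by [A2] and [A11] they become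
    linear in the limit, with slope \<open>c\<close>.\<close>
  define E where "E n x = (\<Sum>j\<in>UNIV. if \<theta>s $ j = 0 then 0
      else \<xi> n $ j * (pen (\<theta>s $ j + \<alpha> n $ j * x $ j) - pen (\<theta>s $ j)))" for n x
  have E_lim: "(\<lambda>n. E n (x n)) \<longlonglongrightarrow> (\<Sum>j\<in>UNIV. if \<theta>s $ j = 0 then 0 else c $ j * x0 $ j)"
    if "x \<longlonglongrightarrow> x0" for x x0
    unfolding E_def
  proof (rule tendsto_sum)
    fix j
    show "(\<lambda>n. if \<theta>s $ j = 0 then 0
      else \<xi> n $ j * (pen (\<theta>s $ j + \<alpha> n $ j * x n $ j) - pen (\<theta>s $ j)))
      \<longlonglongrightarrow> (if \<theta>s $ j = 0 then 0 else c $ j * x0 $ j)"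
    proof (cases "\<theta>s $ j = 0")
      case False
      then show ?thesis
        using tendsto_scaled_increment[OF A2 al[of j] A11 tendsto_vec_nth[OF that]]
        by (simp add: c_def)
    qed simp
  qed
  have c_inner: "(\<Sum>j\<in>UNIV. if \<theta>s $ j = 0 then 0 else c $ j * x $ j) = c \<bullet> x"
    if "\<And>j. \<theta>s $ j = 0 \<Longrightarrow> x $ j = 0" for x
    unfolding inner_vec_def by (rule sum.cong) (auto simp: that)
  \<comment> \<open>\<open>u\<close> maximises the limiting criterion among the vectors of the ball
    supported on the nonzero coordinates: the comparison with a fixed competitor passes to the
    limit.\<close>
  have comp: "L x - c \<bullet> x \<le> L u - c \<bullet> u"
    if x: "\<And>j. \<theta>s $ j = 0 \<Longrightarrow> x $ j = 0" "norm x \<le> R + 1" for x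
  proof -
    have "(\<lambda>n. (H n (\<theta>h n) - H n \<theta>s) - E n (w n)) \<longlonglongrightarrow> L u - c \<bullet> u"
      using tendsto_diff[OF Hw E_lim[OF w_lim]] by (simp add: v0 c_inner u0)
    moreover have "(\<lambda>n. (H n (\<theta>s + diag_mat (\<alpha> n) *v x) - H n \<theta>s) - E n x) \<longlonglongrightarrow> L x - c \<bullet> x"
      using tendsto_diff[OF H_lim[of "\<lambda>_. x" x] E_lim[of "\<lambda>_. x" x]] x by (simp add: c_inner)
    moreover have "\<forall>\<^sub>F n in sequentially. (H n (\<theta>s + diag_mat (\<alpha> n) *v x) - H n \<theta>s) - E n x
        \<le> (H n (\<theta>h n) - H n \<theta>s) - E n (w n)"
      using ev_in[of "\<lambda>_. x" x, OF tendsto_const]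
    proof eventually_elim
      case (elim n)
      have "(\<Sum>j\<in>UNIV. \<xi> n $ j * pen ((\<theta>s + diag_mat (\<alpha> n) *v x) $ j))
          = E n x + (\<Sum>j\<in>UNIV. \<xi> n $ j * pen (\<theta>s $ j))"
        unfolding E_def sum.distrib[symmetric]
        by (rule sum.cong) (auto simp: x algebra_simps)
      \<comment> \<open>Only an inequality: the nonnegative penalty paid by the maximiser on the
        zero coordinates is discarded.\<close>
      moreover have "E n (w n) + (\<Sum>j\<in>UNIV. \<xi> n $ j * pen (\<theta>s $ j))
          \<le> (\<Sum>j\<in>UNIV. \<xi> n $ j * pen (\<theta>h n $ j))"
        unfolding E_def sum.distrib[symmetric]
      proof (rule sum_mono)
        fix j
        show "(if \<theta>s $ j = 0 then 0
           else \<xi> n $ j * (pen (\<theta>s $ j + \<alpha> n $ j * w n $ j) - pen (\<theta>s $ j))) + \<xi> n $ j * pen (\<theta>s $ j)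
           \<le> \<xi> n $ j * pen (\<theta>h n $ j)"
          using xi_pos[of n j] pen_nonneg by (simp add: th_w pen0 algebra_simps)
      qed
      ultimately show ?case using th_max[OF elim, of n] by simp
    qed
    ultimately show ?thesis using tendsto_le[OF sequentially_bot] by blast
  qed
  show "(D - (\<chi> j. \<beta> $ j * deriv pen (\<theta>s $ j))) \<bullet> d = d \<bullet> (sym_part G *v u)"
    if d: "\<And>j. \<theta>s $ j = 0 \<Longrightarrow> d $ j = 0"
  proof -
    \<comment> \<open>The perturbation \<open>t *\<^sub>R d\<close> has norm at most 1, so
      \<open>u + t *\<^sub>R d\<close> is an allowed competitor. Expanding the comparison leaves a
      term linear in \<open>t\<close> bounded by a quadratic one.\<close>
    have "(D - c) \<bullet> d - d \<bullet> (sym_part G *v u) = 0"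
    proof (rule linear_coeff_zero_of_quadratic_bound)
      show "1 / (norm d + 1) > 0" by (simp add: add_nonneg_pos)
      fix t :: real assume t: "\<bar>t\<bar> \<le> 1 / (norm d + 1)"
      have "norm (t *\<^sub>R d) \<le> 1 / (norm d + 1) * norm d"
        using t by (simp add: mult_right_mono del: times_divide_eq_left)
      also have "\<dots> \<le> 1" by (simp add: divide_simps add_nonneg_pos)
      finally have "norm (u + t *\<^sub>R d) \<le> R + 1"
        using norm_triangle_ineq[of u "t *\<^sub>R d"] uR by simp
      then have "L (u + t *\<^sub>R d) - c \<bullet> (u + t *\<^sub>R d) \<le> L u - c \<bullet> u"
        by (intro comp) (simp_all add: d u0)
      then show "t * ((D - c) \<bullet> d - d \<bullet> (sym_part G *v u)) \<le> t\<^sup>2 * ((1/2) * (d \<bullet> (G *v d)))"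
        by (simp add: L_def inner_sym_part inner_add_left inner_add_right inner_diff_left
            matrix_vector_right_distrib matrix_vector_mult_scaleR algebra_simps power2_eq_square)
           (simp add: field_simps)
    qed
    then show ?thesis by (simp add: c_def)
  qed
qed

text \<open>For a positive quadratic form this is the unique critical point, among vectors supported
  on \<open>J\<close>, of the quadratic criterion with linear coefficient
  \<open>fst z - \<psi>\<close>. The symmetric part makes this correct for the possibly asymmetric
  prelimit matrices as well.\<close>

definition block_solution :: "'n set \<Rightarrow> real^'n \<Rightarrow> (real^'n) \<times> (real^'n^'n) \<Rightarrow> real^'n" where
  "block_solution J \<psi> z = sub_inv J (sym_part (snd z)) *v sub_vec J (fst z - \<psi>)"

lemma continuous_on_block_solution:
  fixes J :: "'n::finite set"
  shows "continuous_on (UNIV \<times> {M. \<forall>x. x \<noteq> 0 \<longrightarrow> x \<bullet> (M *v x) > 0}) (block_solution J \<psi>)"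
  unfolding block_solution_def sub_inv_eq
proof (rule continuous_on_matrix_inv_mult)
  fix z :: "(real^'n) \<times> (real^'n^'n)"
  assume "z \<in> UNIV \<times> {M. \<forall>x. x \<noteq> 0 \<longrightarrow> x \<bullet> (M *v x) > 0}"
  then show "det (block_id J (sym_part (snd z))) \<noteq> 0"
    by (intro det_block_id_nonzero) (auto simp: inner_sym_part)
qed (intro continuous_intros)+

lemma borel_measurable_block_solution:
  "block_solution J \<psi> \<in> borel_measurable borel"
  unfolding block_solution_def sub_inv_eq
  by (rule borel_measurable_matrix_inv_mult) (intro continuous_intros)+

lemma borel_measurable_sub_inv_mult:
  fixes D :: "'a \<Rightarrow> real^'n"
  assumes "D \<in> borel_measurable M" "G \<in> borel_measurable M"
  shows "(\<lambda>\<omega>. sub_inv J (G \<omega>) *v sub_vec J (D \<omega> - \<psi>)) \<in> borel_measurable M"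
proof -
  have "(\<lambda>z. matrix_inv (block_id J (snd z)) *v sub_vec J (fst z - \<psi>)) \<in> borel_measurable borel"
    by (rule borel_measurable_matrix_inv_mult) (intro continuous_intros)+
  from measurable_compose[OF borel_measurable_Pair[OF assms] this]
  show ?thesis by (simp add: sub_inv_eq)
qed

text \<open>The index set absorbs the pairs \<open>(T, \<omega>)\<close>: the closeness is uniform over them, by
  extracting a convergent subsequence from a hypothetical sequence of violations.\<close>

lemma penalized_argmax_close:
  fixes I :: "'i set" and \<Theta> :: "(real^'p) set" and \<theta>s :: "real^'p"
    and \<alpha> \<xi> \<theta>h \<Delta> :: "'i \<Rightarrow> real^'p"
    and \<Gamma> :: "'i \<Rightarrow> real^'p^'p" and H r :: "'i \<Rightarrow> real^'p \<Rightarrow> real"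
    and pen :: "real \<Rightarrow> real" and q :: real and \<beta> :: "real^'p"
  defines "ut \<equiv> \<lambda>i. \<chi> j. (\<theta>h i $ j - \<theta>s $ j) / (if \<theta>s $ j = 0 then (\<xi> i $ j) powr (-1/q) else \<alpha> i $ j)"
    and "\<psi> \<equiv> \<chi> j. \<beta> $ j * deriv pen (\<theta>s $ j)"
  assumes Theta: "open \<Theta>" "\<theta>s \<in> \<Theta>"
    and xi_pos: "\<And>i j. i \<in> I \<Longrightarrow> \<xi> i $ j > 0" and al_nz: "\<And>i j. i \<in> I \<Longrightarrow> \<alpha> i $ j \<noteq> 0"
    and pen_nonneg: "\<And>x. pen x \<ge> 0" and pen0: "pen 0 = 0"
    and q: "0 < q"
    and A2: "\<And>x. x \<noteq> 0 \<Longrightarrow> pen differentiable (at x)"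
    and A5: "((\<lambda>x. pen x / \<bar>x\<bar> powr q) \<longlongrightarrow> lam) (at 0)" "lam > 0"
    and th: "\<And>i. i \<in> I \<Longrightarrow> \<theta>h i \<in> closure \<Theta>"
    and th_max: "\<And>i \<theta>. i \<in> I \<Longrightarrow> \<theta> \<in> closure \<Theta> \<Longrightarrow> H i \<theta> - (\<Sum>j\<in>UNIV. \<xi> i $ j * pen (\<theta> $ j))
           \<le> H i (\<theta>h i) - (\<Sum>j\<in>UNIV. \<xi> i $ j * pen (\<theta>h i $ j))"
    and laq: "\<And>i u. i \<in> I \<Longrightarrow> \<theta>s + diag_mat (\<alpha> i) *v u \<in> closure \<Theta> \<Longrightarrow>
        H i (\<theta>s + diag_mat (\<alpha> i) *v u) - H i \<theta>s
          = \<Delta> i \<bullet> u - (1/2) * (u \<bullet> (\<Gamma> i *v u)) + r i u"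
    and K: "compact K" "K \<subseteq> UNIV \<times> {M. \<forall>x. x \<noteq> 0 \<longrightarrow> x \<bullet> (M *v x) > 0}" and e: "e > 0"
  shows "\<exists>\<eta>>0. \<forall>i\<in>I. norm (ut i) \<le> R \<longrightarrow> (\<Delta> i, \<Gamma> i) \<in> K \<longrightarrow>
    (\<forall>j. \<bar>\<alpha> i $ j\<bar> \<le> \<eta>) \<longrightarrow>
    (\<forall>j. \<theta>s $ j = 0 \<longrightarrow> \<bar>(\<xi> i $ j) powr (-1/q) * inverse \<bar>\<alpha> i $ j\<bar>\<bar> \<le> \<eta>) \<longrightarrow>
    (\<forall>j. \<theta>s $ j \<noteq> 0 \<longrightarrow> \<bar>\<xi> i $ j * \<alpha> i $ j - \<beta> $ j\<bar> \<le> \<eta>) \<longrightarrow>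
    (\<forall>u. \<theta>s + diag_mat (\<alpha> i) *v u \<in> closure \<Theta> \<longrightarrow> norm u \<le> R + 1 \<longrightarrow> \<bar>r i u\<bar> \<le> \<eta>) \<longrightarrow>
    norm (sub_vec {j. \<theta>s $ j = 0} (ut i)) \<le> e \<and>
    dist (sub_vec {j. \<theta>s $ j \<noteq> 0} (ut i)) (block_solution {j. \<theta>s $ j \<noteq> 0} \<psi> (\<Delta> i, \<Gamma> i)) \<le> e"
    (is "\<exists>\<eta>>0. \<forall>i\<in>I. ?small \<eta> i")
proof (rule ccontr)
  let ?g = "block_solution {j. \<theta>s $ j \<noteq> 0} \<psi>"
  assume neg: "\<not> ?thesis"
  \<comment> \<open>One violation at each level \<open>1 / real (Suc n)\<close>, so that the
    smallness bounds become null sequences.\<close>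
  have "\<exists>i. i \<in> I \<and> \<not> ?small (1 / real (Suc n)) i" for n
  proof -
    have "1 / real (Suc n) > 0" by simp
    with neg show ?thesis by blast
  qed
  then obtain i where i: "\<And>n. i n \<in> I" "\<And>n. \<not> ?small (1 / real (Suc n)) (i n)"
    by metis
  have i_R: "norm (ut (i n)) \<le> R" for n using i(2)[of n] by argo
  have i_K: "(\<Delta> (i n), \<Gamma> (i n)) \<in> K" for n using i(2)[of n] by argo
  have i_al: "\<forall>j. \<bar>\<alpha> (i n) $ j\<bar> \<le> 1 / real (Suc n)" for n using i(2)[of n] by argo
  have i_A6: "\<forall>j. \<theta>s $ j = 0 \<longrightarrow> \<bar>(\<xi> (i n) $ j) powr (-1/q) * inverse \<bar>\<alpha> (i n) $ j\<bar>\<bar> \<le> 1 / real (Suc n)" for n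
    using i(2)[of n] by argo
  have i_A11: "\<forall>j. \<theta>s $ j \<noteq> 0 \<longrightarrow> \<bar>\<xi> (i n) $ j * \<alpha> (i n) $ j - \<beta> $ j\<bar> \<le> 1 / real (Suc n)" for n
    using i(2)[of n] by argo
  have i_rem: "\<forall>u. \<theta>s + diag_mat (\<alpha> (i n)) *v u \<in> closure \<Theta> \<longrightarrow> norm u \<le> R + 1 \<longrightarrow> \<bar>r (i n) u\<bar> \<le> 1 / real (Suc n)" for n
    using i(2)[of n] by argo
  have i_neg: "\<not> (norm (sub_vec {j. \<theta>s $ j = 0} (ut (i n))) \<le> e \<and>
    dist (sub_vec {j. \<theta>s $ j \<noteq> 0} (ut (i n))) (?g (\<Delta> (i n), \<Gamma> (i n))) \<le> e)" for n
    using i(2)[of n] by argo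
  \<comment> \<open>Only the normalised estimator and the coefficients need a convergent
    subsequence; they live in a compact product.\<close>
  have "compact (cball (0 :: real^'p) R \<times> K)" by (intro compact_Times compact_cball K)
  moreover have "(ut (i n), \<Delta> (i n), \<Gamma> (i n)) \<in> cball 0 R \<times> K" for n
    using i_R i_K by simp
  ultimately obtain p s where p: "p \<in> cball 0 R \<times> K" and s: "strict_mono s"
    and lim: "((\<lambda>n. (ut (i n), \<Delta> (i n), \<Gamma> (i n))) \<circ> s) \<longlonglongrightarrow> p"
    unfolding compact_def by (metis (no_types, lifting))
  obtain u D G where p_eq: "p = (u, D, G)" by (cases p)
  define k where "k n = i (s n)" for n
  have k: "k n \<in> I" for n by (simp add: k_def i)
  have lims: "(\<lambda>n. ut (k n)) \<longlonglongrightarrow> u" "(\<lambda>n. \<Delta> (k n)) \<longlonglongrightarrow> D" "(\<lambda>n. \<Gamma> (k n)) \<longlonglongrightarrow> G"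
    using tendsto_fst[OF lim] tendsto_fst[OF tendsto_snd[OF lim]] tendsto_snd[OF tendsto_snd[OF lim]]
    by (simp_all add: p_eq k_def o_def)
  have uR: "norm u \<le> R" and DG: "(D, G) \<in> K" using p by (auto simp: p_eq)
  define \<rho> where "\<rho> n = 1 / real (Suc (s n))" for n
  have rho: "\<rho> \<longlonglongrightarrow> 0"
    unfolding \<rho>_def using LIMSEQ_subseq_LIMSEQ[OF LIMSEQ_inverse_real_of_nat s]
    by (simp add: o_def inverse_eq_divide)
  have null: "X \<longlonglongrightarrow> b" if "\<And>n. \<bar>X n - b\<bar> \<le> \<rho> n" for X and b :: real
    by (rule LIM_zero_cancel, rule Lim_null_comparison[OF _ rho]) (simp add: that)
  note core = penalized_argmax_limit[where \<Theta>=\<Theta> and \<theta>s=\<theta>s and \<alpha>="\<lambda>n. \<alpha> (k n)" and \<xi>="\<lambda>n. \<xi> (k n)"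
    and \<theta>h="\<lambda>n. \<theta>h (k n)" and \<Delta>="\<lambda>n. \<Delta> (k n)" and \<Gamma>="\<lambda>n. \<Gamma> (k n)" and H="\<lambda>n. H (k n)"
    and r="\<lambda>n. r (k n)" and R=R and \<rho>=\<rho> and \<beta>=\<beta> and u=u and D=D and G=G
    and pen=pen and q=q and lam=lam,
    OF Theta xi_pos[OF k] al_nz[OF k] pen_nonneg pen0 q A2 A5 th[OF k] th_max[OF k] laq[OF k] _ rho _ _ _ _ uR lims(2,3)]
  have prem:
    "\<bar>r (k n) x\<bar> \<le> \<rho> n" if "\<theta>s + diag_mat (\<alpha> (k n)) *v x \<in> closure \<Theta>" "norm x \<le> R + 1" for n x
    using i_rem[of "s n"] that by (simp add: k_def \<rho>_def)
  have prem2: "(\<lambda>n. \<alpha> (k n) $ j) \<longlonglongrightarrow> 0" for j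
    by (rule null) (use i_al in \<open>simp add: k_def \<rho>_def\<close>)
  have prem3: "(\<lambda>n. (\<xi> (k n) $ j) powr (-1/q) * inverse \<bar>\<alpha> (k n) $ j\<bar>) \<longlonglongrightarrow> 0" if "\<theta>s $ j = 0" for j
    by (rule null) (use i_A6 that in \<open>simp add: k_def \<rho>_def\<close>)
  have prem4: "(\<lambda>n. \<xi> (k n) $ j * \<alpha> (k n) $ j) \<longlonglongrightarrow> \<beta> $ j" if "\<theta>s $ j \<noteq> 0" for j
    by (rule null) (use i_A11 that in \<open>simp add: k_def \<rho>_def\<close>)
  note core' = core[OF _ _ _ prem prem2 prem3 prem4 lims(1)[unfolded ut_def]]
  have u0: "u $ j = 0" if "\<theta>s $ j = 0" for j
    by (rule core'(1)) (use that in auto)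
  have G: "x \<bullet> (G *v x) > 0" if "x \<noteq> 0" for x using K(2) DG that by auto
  \<comment> \<open>The limit satisfies the first-order condition, hence equals the block solution
    at the limit coefficients. Estimator and block solution then share the limit \<open>u\<close>
    along the subsequence, against the assumed violation.\<close>
  have "?g (D, G) = u"
    unfolding block_solution_def fst_conv snd_conv
  proof (rule sub_inv_mult_solution)
    show "x \<bullet> (sym_part G *v x) > 0" if "x \<noteq> 0" for x
      using G[OF that] by (simp add: inner_sym_part)
    show "(D - \<psi>) \<bullet> d = d \<bullet> (sym_part G *v u)" if "\<And>j. j \<notin> {j. \<theta>s $ j \<noteq> 0} \<Longrightarrow> d $ j = 0" for d
      unfolding \<psi>_def by (rule core'(2)) (use that in auto)
  qed (use u0 in auto)
  moreover have "isCont ?g (D, G)"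
  proof -
    have "open ((UNIV :: (real^'p) set) \<times> {M :: real^'p^'p. \<forall>x. x \<noteq> 0 \<longrightarrow> x \<bullet> (M *v x) > 0})"
      by (intro open_Times open_positive_quadratic_form open_UNIV)
    then show ?thesis
      using continuous_on_block_solution continuous_on_eq_continuous_at K(2) DG by blast
  qed
  ultimately have g_lim: "(\<lambda>n. ?g (\<Delta> (k n), \<Gamma> (k n))) \<longlonglongrightarrow> u"
    using isCont_tendsto_compose[of "(D, G)" ?g, OF _ tendsto_Pair[OF lims(2,3)]] by simp
  have sv: "(\<lambda>n. sub_vec J (ut (k n))) \<longlonglongrightarrow> sub_vec J u" for J
  proof (rule vec_tendstoI)
    show "(\<lambda>n. sub_vec J (ut (k n)) $ j) \<longlonglongrightarrow> sub_vec J u $ j" for j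
      using tendsto_vec_nth[OF lims(1), of j] by (cases "j \<in> J") simp_all
  qed
  have "sub_vec {j. \<theta>s $ j = 0} u = 0" "sub_vec {j. \<theta>s $ j \<noteq> 0} u = u"
    using u0 by (auto simp: vec_eq_iff)
  then have "(\<lambda>n. norm (sub_vec {j. \<theta>s $ j = 0} (ut (k n)))) \<longlonglongrightarrow> 0"
    "(\<lambda>n. dist (sub_vec {j. \<theta>s $ j \<noteq> 0} (ut (k n))) (?g (\<Delta> (k n), \<Gamma> (k n)))) \<longlonglongrightarrow> 0"
    using tendsto_norm[OF sv[of "{j. \<theta>s $ j = 0}"]] tendsto_dist[OF sv[of "{j. \<theta>s $ j \<noteq> 0}"] g_lim]
    by simp_all
  from order_tendstoD(2)[OF this(1) e] order_tendstoD(2)[OF this(2) e]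
  have "\<forall>\<^sub>F n in sequentially. False"
  proof eventually_elim
    case (elim n)
    with i_neg[of "s n"] show ?case unfolding k_def by linarith
  qed
  then show False by simp
qed

theorem theorem4:
  fixes P :: "'a measure"
    and TT :: "real set"
    and \<Theta> :: "(real^'p) set"
    and \<theta>s :: "real^'p"
    and H :: "real \<Rightarrow> 'a \<Rightarrow> real^'p \<Rightarrow> real"
    and \<xi> :: "real \<Rightarrow> 'a \<Rightarrow> real^'p"
    and pen :: "real \<Rightarrow> real"
    and \<theta>h :: "real \<Rightarrow> 'a \<Rightarrow> real^'p"
    and \<alpha> :: "real \<Rightarrow> real^'p"
    and q :: real
    and \<Delta>T :: "real \<Rightarrow> 'a \<Rightarrow> real^'p"
    and \<Delta> :: "'a \<Rightarrow> real^'p"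
    and \<Gamma>T :: "real \<Rightarrow> 'a \<Rightarrow> real^'p^'p"
    and \<Gamma> :: "'a \<Rightarrow> real^'p^'p"
    and r :: "real \<Rightarrow> 'a \<Rightarrow> real^'p \<Rightarrow> real"
    and \<beta> :: "real^'p"
  defines "J0 \<equiv> {j. \<theta>s $ j = 0}"
    and "J1 \<equiv> {j. \<theta>s $ j \<noteq> 0}"
    and "U \<equiv> (\<lambda>T. {u. \<theta>s + diag_mat (\<alpha> T) *v u \<in> closure \<Theta>})"
    and "atil \<equiv> (\<lambda>T \<omega>. \<chi> j. if \<theta>s $ j = 0 then (\<xi> T \<omega> $ j) powr (-1/q) else \<alpha> T $ j)"
  assumes P: "prob_space P"
    and TT_nonneg: "TT \<subseteq> {0..}"
    and TT_unbounded: "\<forall>x. \<exists>T\<in>TT. T > x"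
    and Theta: "open \<Theta>" "bounded \<Theta>" "\<theta>s \<in> \<Theta>"
    and H_cont: "\<forall>T\<in>TT. \<forall>\<omega>\<in>space P. continuous_on (closure \<Theta>) (H T \<omega>)"
    and H_meas: "\<forall>T\<in>TT. \<forall>\<theta>\<in>closure \<Theta>. (\<lambda>\<omega>. H T \<omega> \<theta>) \<in> borel_measurable P"
    and xi_pos: "\<forall>T\<in>TT. \<forall>\<omega>\<in>space P. \<forall>j. \<xi> T \<omega> $ j > 0"
    and xi_meas: "\<forall>T\<in>TT. \<xi> T \<in> borel_measurable P"
    and pen_nonneg: "\<forall>x. pen x \<ge> 0"
    and pen0: "pen 0 = 0"
    and th_meas: "\<forall>T\<in>TT. \<theta>h T \<in> borel_measurable P"
    and th_max: "\<forall>T\<in>TT. \<forall>\<omega>\<in>space P. \<theta>h T \<omega> \<in> closure \<Theta> \<and>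
        (\<forall>\<theta>\<in>closure \<Theta>. H T \<omega> \<theta> - (\<Sum>j\<in>UNIV. \<xi> T \<omega> $ j * pen (\<theta> $ j))
           \<le> H T \<omega> (\<theta>h T \<omega>) - (\<Sum>j\<in>UNIV. \<xi> T \<omega> $ j * pen (\<theta>h T \<omega> $ j)))"
    and a_inv: "\<forall>T\<in>TT. invertible (diag_mat (\<alpha> T))"
    and a_norm: "((\<lambda>T. onorm (\<lambda>u. diag_mat (\<alpha> T) *v u)) \<longlongrightarrow> 0) (along TT)"
    and q: "0 < q" "q \<le> 1"
    and A2: "\<forall>x. x \<noteq> 0 \<longrightarrow> pen differentiable (at x)"
    and A5: "\<exists>lam>0. ((\<lambda>x. pen x / \<bar>x\<bar> powr q) \<longlongrightarrow> lam) (at 0)"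
    and A6: "\<forall>j\<in>J0. conv_prob P (along TT)
        (\<lambda>T \<omega>. (\<xi> T \<omega> $ j) powr (-1/q) * inverse \<bar>\<alpha> T $ j\<bar>) (\<lambda>\<omega>. 0)"
    and A10_meas: "\<forall>T\<in>TT. \<Delta>T T \<in> borel_measurable P \<and> \<Gamma>T T \<in> borel_measurable P"
      "\<Delta> \<in> borel_measurable P" "\<Gamma> \<in> borel_measurable P"
    and A10_i: "\<forall>T\<in>TT. \<forall>\<omega>\<in>space P. \<forall>u\<in>U T.
        H T \<omega> (\<theta>s + diag_mat (\<alpha> T) *v u) - H T \<omega> \<theta>s
          = \<Delta>T T \<omega> \<bullet> u - (1/2) * (u \<bullet> (\<Gamma>T T \<omega> *v u)) + r T \<omega> u"
    and A10_ii: "AE \<omega> in P. pos_def (\<Gamma> \<omega>)"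
    and A10_iii: "conv_distr P (along TT) (\<lambda>T \<omega>. (\<Delta>T T \<omega>, \<Gamma>T T \<omega>)) (\<lambda>\<omega>. (\<Delta> \<omega>, \<Gamma> \<omega>))"
    and A10_iv: "\<forall>R>0. conv_prob P (along TT)
        (\<lambda>T \<omega>. SUP u\<in>{u \<in> U T. norm u \<le> R}. \<bar>r T \<omega> u\<bar>) (\<lambda>\<omega>. 0)"
    and A11: "\<forall>j\<in>J1. conv_prob P (along TT) (\<lambda>T \<omega>. \<xi> T \<omega> $ j * \<alpha> T $ j) (\<lambda>\<omega>. \<beta> $ j)"
    and tight: "tight_family P TT (\<lambda>T \<omega>. \<chi> j. (\<theta>h T \<omega> $ j - \<theta>s $ j) / atil T \<omega> $ j)"
  shows "conv_prob P (along TT)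
           (\<lambda>T \<omega>. sub_vec J0 (\<chi> j. (\<theta>h T \<omega> $ j - \<theta>s $ j) / atil T \<omega> $ j)) (\<lambda>\<omega>. 0)
       \<and> conv_distr P (along TT)
           (\<lambda>T \<omega>. sub_vec J1 (\<chi> j. (\<theta>h T \<omega> $ j - \<theta>s $ j) / atil T \<omega> $ j))
           (\<lambda>\<omega>. sub_inv J1 (\<Gamma> \<omega>) *v
                  sub_vec J1 (\<Delta> \<omega> - (\<chi> j. \<beta> $ j * deriv pen (\<theta>s $ j))))"
proof -
  interpret prob_space P by fact
  define ut where "ut T \<omega> = (\<chi> j. (\<theta>h T \<omega> $ j - \<theta>s $ j) / atil T \<omega> $ j)" for T \<omega>
  have ut_eq: "ut T \<omega> = (\<chi> j. (\<theta>h T \<omega> $ j - \<theta>s $ j) /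
      (if \<theta>s $ j = 0 then (\<xi> T \<omega> $ j) powr (-1/q) else \<alpha> T $ j))" for T \<omega>
    by (simp add: ut_def atil_def)
  define \<psi> where "\<psi> = (\<chi> j. \<beta> $ j * deriv pen (\<theta>s $ j))"
  define ZT where "ZT T \<omega> = (\<Delta>T T \<omega>, \<Gamma>T T \<omega>)" for T \<omega>
  define Z where "Z \<omega> = (\<Delta> \<omega>, \<Gamma> \<omega>)" for \<omega>
  \<comment> \<open>The open set that carries the limit law by [A10](ii) and on which the solution
    map is continuous.\<close>
  define G where "G = (UNIV :: (real^'p) set) \<times> {M :: real^'p^'p. \<forall>x. x \<noteq> 0 \<longrightarrow> x \<bullet> (M *v x) > 0}"
  let ?F = "along TT" and ?g = "block_solution J1 \<psi>"
  obtain lam where lam: "lam > 0" "((\<lambda>x. pen x / \<bar>x\<bar> powr q) \<longlongrightarrow> lam) (at 0)"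
    using A5 by blast
  have al_nz: "\<alpha> T $ j \<noteq> 0" if "T \<in> TT" for T j
    using a_inv that invertible_diag_mat_nth by blast
  have xi_j: "(\<lambda>\<omega>. \<xi> T \<omega> $ j) \<in> borel_measurable P" if "T \<in> TT" for T j
    using xi_meas that by (intro borel_measurable_vec_nth) blast
  have th_j: "(\<lambda>\<omega>. \<theta>h T \<omega> $ j) \<in> borel_measurable P" if "T \<in> TT" for T j
    using th_meas that by (intro borel_measurable_vec_nth) blast
  have ut_meas: "ut T \<in> borel_measurable P" if T: "T \<in> TT" for T
    unfolding ut_def[abs_def]
  proof (rule borel_measurable_vec_lambda)
    fix j
    show "(\<lambda>\<omega>. (\<theta>h T \<omega> $ j - \<theta>s $ j) / atil T \<omega> $ j) \<in> borel_measurable P"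
      using th_j[OF T, of j] xi_j[OF T, of j]
      by (cases "\<theta>s $ j = 0") (simp_all add: atil_def)
  qed
  have ZT_meas: "ZT T \<in> borel_measurable P" if "T \<in> TT" for T
    unfolding ZT_def[abs_def] using A10_meas(1) that by (intro borel_measurable_Pair) auto
  have Z_meas: "Z \<in> borel_measurable P"
    unfolding Z_def[abs_def] using A10_meas(2,3) by (intro borel_measurable_Pair)
  have Z_conv: "conv_distr P ?F ZT Z"
    using A10_iii by (simp add: ZT_def[abs_def] Z_def[abs_def])
  have G_open: "open G"
    unfolding G_def by (intro open_Times open_positive_quadratic_form open_UNIV)
  have Z_G: "AE \<omega> in P. Z \<omega> \<in> G"
    using A10_ii by eventually_elim (auto simp: Z_def G_def pos_def_def)

  \<comment> \<open>Smallness of the error terms with high probability\<close>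
  have small_alpha: "whp P ?F (\<lambda>T \<omega>. \<forall>j. \<bar>\<alpha> T $ j\<bar> \<le> \<eta>)" if "\<eta> > 0" for \<eta>
  proof (rule whp_always)
    show "\<forall>\<^sub>F T in ?F. \<forall>\<omega>\<in>space P. \<forall>j. \<bar>\<alpha> T $ j\<bar> \<le> \<eta>"
      using order_tendstoD(2)[OF a_norm that]
    proof eventually_elim
      case (elim T)
      then show ?case
        using abs_diag_mat_nth_le_onorm[of "\<alpha> T"] by (meson less_imp_le order_trans)
    qed
  qed
  have small_A6: "whp P ?F (\<lambda>T \<omega>. \<forall>j\<in>J0. \<bar>(\<xi> T \<omega> $ j) powr (-1/q) * inverse \<bar>\<alpha> T $ j\<bar>\<bar> \<le> \<eta>)" if "\<eta> > 0" for \<eta>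
  proof (rule whp_ball_finite[OF P])
    fix j assume "j \<in> J0"
    have "whp P ?F (\<lambda>T \<omega>. dist ((\<xi> T \<omega> $ j) powr (-1/q) * inverse \<bar>\<alpha> T $ j\<bar>) 0 \<le> \<eta>)"
    proof (rule whp_of_conv_prob[OF A6[rule_format, OF \<open>j \<in> J0\<close>] that], rule eventually_along)
      fix T assume "T \<in> TT"
      note [measurable] = xi_j[OF this, of j]
      show "{\<omega> \<in> space P. dist ((\<xi> T \<omega> $ j) powr (-1/q) * inverse \<bar>\<alpha> T $ j\<bar>) 0 > \<eta>} \<in> sets P"
        by measurable
    qed
    then show "whp P ?F (\<lambda>T \<omega>. \<bar>(\<xi> T \<omega> $ j) powr (-1/q) * inverse \<bar>\<alpha> T $ j\<bar>\<bar> \<le> \<eta>)"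
      by (simp add: dist_real_def)
  qed simp
  have small_A11: "whp P ?F (\<lambda>T \<omega>. \<forall>j\<in>J1. \<bar>\<xi> T \<omega> $ j * \<alpha> T $ j - \<beta> $ j\<bar> \<le> \<eta>)" if "\<eta> > 0" for \<eta>
  proof (rule whp_ball_finite[OF P])
    fix j assume "j \<in> J1"
    have "whp P ?F (\<lambda>T \<omega>. dist (\<xi> T \<omega> $ j * \<alpha> T $ j) (\<beta> $ j) \<le> \<eta>)"
    proof (rule whp_of_conv_prob[OF A11[rule_format, OF \<open>j \<in> J1\<close>] that], rule eventually_along)
      fix T assume "T \<in> TT"
      note [measurable] = xi_j[OF this, of j]
      show "{\<omega> \<in> space P. dist (\<xi> T \<omega> $ j * \<alpha> T $ j) (\<beta> $ j) > \<eta>} \<in> sets P"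
        by measurable
    qed
    then show "whp P ?F (\<lambda>T \<omega>. \<bar>\<xi> T \<omega> $ j * \<alpha> T $ j - \<beta> $ j\<bar> \<le> \<eta>)"
      by (simp add: dist_real_def)
  qed simp
  \<comment> \<open>[A10](iv) concerns a supremum over a possibly uncountable set; finiteness and
    measurability come first, so that it can be read as a bound at every point off a small
    event.\<close>
  have small_r: "whp P ?F (\<lambda>T \<omega>. \<forall>u. \<theta>s + diag_mat (\<alpha> T) *v u \<in> closure \<Theta> \<longrightarrow> norm u \<le> R \<longrightarrow> \<bar>r T \<omega> u\<bar> \<le> \<eta>)"
    if "\<eta> > 0" "R > 0" for \<eta> R
  proof -
    define S where "S T = {u \<in> U T. norm u \<le> R}" for T
    have aff_cont: "continuous_on A (\<lambda>u. \<theta>s + diag_mat (\<alpha> T) *v u)" for A T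
      by (intro continuous_intros)
    have S_compact: "compact (S T)" for T
    proof -
      have "U T = (\<lambda>u. \<theta>s + diag_mat (\<alpha> T) *v u) -` closure \<Theta>" by (auto simp: U_def)
      then have "closed (U T)" using aff_cont by (simp add: continuous_on_closed_vimage closed_vimage)
      moreover have "S T = U T \<inter> cball 0 R" by (auto simp: S_def)
      ultimately show ?thesis by (simp add: closed_Int_compact)
    qed
    have "0 \<in> S T" for T
      using Theta(3) closure_subset \<open>R > 0\<close> by (auto simp: S_def U_def)
    then have S_ne: "S T \<noteq> {}" for T by blast
    \<comment> \<open>The expansion expresses the remainder through the criterion and the
      coefficients, from which it inherits continuity in \<open>u\<close> and measurability in
      \<omega>.\<close>
    have r_eq: "r T \<omega> u = H T \<omega> (\<theta>s + diag_mat (\<alpha> T) *v u) - H T \<omega> \<theta>s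
        - (\<Delta>T T \<omega> \<bullet> u - (1/2) * (u \<bullet> (\<Gamma>T T \<omega> *v u)))"
      if "T \<in> TT" "\<omega> \<in> space P" "u \<in> S T" for T \<omega> u
      using A10_i[rule_format, OF that(1,2), of u] that(3) by (simp add: S_def)
    have r_cont: "continuous_on (S T) (\<lambda>u. \<bar>r T \<omega> u\<bar>)" if T: "T \<in> TT" "\<omega> \<in> space P" for T \<omega>
    proof -
      have "continuous_on (S T) (\<lambda>u. H T \<omega> (\<theta>s + diag_mat (\<alpha> T) *v u))"
        by (rule continuous_on_compose2[OF H_cont[rule_format, OF T] aff_cont]) (auto simp: S_def U_def)
      then have "continuous_on (S T) (\<lambda>u. \<bar>H T \<omega> (\<theta>s + diag_mat (\<alpha> T) *v u) - H T \<omega> \<theta>s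
        - (\<Delta>T T \<omega> \<bullet> u - (1/2) * (u \<bullet> (\<Gamma>T T \<omega> *v u)))\<bar>)"
        by (intro continuous_intros)
      then show ?thesis by (rule continuous_on_eq) (simp add: r_eq[OF T])
    qed
    have r_meas: "(\<lambda>\<omega>. \<bar>r T \<omega> u\<bar>) \<in> borel_measurable P" if T: "T \<in> TT" and u: "u \<in> S T" for T u
    proof -
      have [measurable]: "(\<lambda>\<omega>. H T \<omega> (\<theta>s + diag_mat (\<alpha> T) *v u)) \<in> borel_measurable P"
        "(\<lambda>\<omega>. H T \<omega> \<theta>s) \<in> borel_measurable P"
        using H_meas T u Theta(3) closure_subset by (auto simp: S_def U_def)
      have "(\<lambda>z. fst z \<bullet> u - (1/2) * (u \<bullet> (snd z *v u))) \<in> borel_measurable (borel :: ((real^'p) \<times> (real^'p^'p)) measure)"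
        by (intro borel_measurable_continuous_onI continuous_intros)
      from measurable_compose[OF ZT_meas[OF T] this]
      have [measurable]: "(\<lambda>\<omega>. \<Delta>T T \<omega> \<bullet> u - (1/2) * (u \<bullet> (\<Gamma>T T \<omega> *v u))) \<in> borel_measurable P"
        by (simp add: ZT_def)
      have "(\<lambda>\<omega>. \<bar>H T \<omega> (\<theta>s + diag_mat (\<alpha> T) *v u) - H T \<omega> \<theta>s
        - (\<Delta>T T \<omega> \<bullet> u - (1/2) * (u \<bullet> (\<Gamma>T T \<omega> *v u)))\<bar>) \<in> borel_measurable P"
        by measurable
      then show ?thesis
        by (rule measurable_cong[THEN iffD1, rotated]) (simp add: r_eq[OF T _ u])
    qed
    have r_bdd: "bdd_above ((\<lambda>u. \<bar>r T \<omega> u\<bar>) ` S T)" if "T \<in> TT" "\<omega> \<in> space P" for T \<omega>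
      using compact_continuous_image[OF r_cont[OF that] S_compact]
      by (simp add: compact_imp_bounded bounded_imp_bdd_above)
    \<comment> \<open>Nonnegativity identifies the supremum with its distance to 0.\<close>
    have sup_nonneg: "(SUP u\<in>S T. \<bar>r T \<omega> u\<bar>) \<ge> 0" if "T \<in> TT" "\<omega> \<in> space P" for T \<omega>
      using cSUP_upper2[OF r_bdd[OF that], of 0 0] \<open>\<And>T. 0 \<in> S T\<close> by simp
    have "whp P ?F (\<lambda>T \<omega>. dist (SUP u\<in>S T. \<bar>r T \<omega> u\<bar>) 0 \<le> \<eta>)"
    proof (rule whp_of_conv_prob[OF _ that(1)])
      show "conv_prob P ?F (\<lambda>T \<omega>. SUP u\<in>S T. \<bar>r T \<omega> u\<bar>) (\<lambda>\<omega>. 0)"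
        using A10_iv \<open>R > 0\<close> by (simp add: S_def)
      show "\<forall>\<^sub>F T in ?F. {\<omega> \<in> space P. dist (SUP u\<in>S T. \<bar>r T \<omega> u\<bar>) 0 > \<eta>} \<in> sets P"
      proof (rule eventually_along)
        fix T assume T: "T \<in> TT"
        have "{\<omega> \<in> space P. dist (SUP u\<in>S T. \<bar>r T \<omega> u\<bar>) 0 > \<eta>}
            = {\<omega> \<in> space P. (SUP u\<in>S T. \<bar>r T \<omega> u\<bar>) > \<eta>}"
          using sup_nonneg[OF T] by (auto simp: dist_real_def)
        also have "\<dots> \<in> sets P"
          using S_compact S_ne r_cont[OF T] r_meas[OF T] by (intro sets_SUP_greater)
        finally show "{\<omega> \<in> space P. dist (SUP u\<in>S T. \<bar>r T \<omega> u\<bar>) 0 > \<eta>} \<in> sets P" .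
      qed
    qed
    then show ?thesis
    proof (rule whp_mono, intro eventually_along ballI impI allI)
      fix T \<omega> u
      assume T: "T \<in> TT" "\<omega> \<in> space P" and d: "dist (SUP u\<in>S T. \<bar>r T \<omega> u\<bar>) 0 \<le> \<eta>"
        and u: "\<theta>s + diag_mat (\<alpha> T) *v u \<in> closure \<Theta>" "norm u \<le> R"
      have "\<bar>r T \<omega> u\<bar> \<le> (SUP u\<in>S T. \<bar>r T \<omega> u\<bar>)"
        using u by (intro cSUP_upper r_bdd T) (simp add: S_def U_def)
      then show "\<bar>r T \<omega> u\<bar> \<le> \<eta>" using d by (simp add: dist_real_def)
    qed
  qed

  \<comment> \<open>Uniform closeness to the block solution\<close>
  have close: "whp P ?F (\<lambda>T \<omega>. ZT T \<omega> \<in> K \<longrightarrow>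
      norm (sub_vec J0 (ut T \<omega>)) \<le> e \<and> dist (sub_vec J1 (ut T \<omega>)) (?g (ZT T \<omega>)) \<le> e)"
    if K: "compact K" "K \<subseteq> G" and e: "e > 0" for K e
  proof (rule whp_localize[OF P])
    fix \<epsilon> :: real assume "\<epsilon> > 0"
    \<comment> \<open>Tightness makes the localisation to a bounded normalised estimator cost at
      most \<epsilon>.\<close>
    obtain R0 where R0: "\<forall>\<^sub>F T in ?F. \<exists>B\<in>sets P. measure P B \<le> \<epsilon> \<and> (\<forall>\<omega>\<in>space P - B. norm (ut T \<omega>) \<le> R0)"
      using tight_family_eventually[of P TT ut \<epsilon>] tight ut_meas \<open>\<epsilon> > 0\<close>
      by (auto simp: ut_def[abs_def])
    \<comment> \<open>The maximum with 0 ensures \<open>R + 1 > 0\<close>, as the remainder bound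
      demands.\<close>
    define R where "R = max R0 0"
    have R: "\<forall>\<^sub>F T in ?F. \<exists>B\<in>sets P. measure P B \<le> \<epsilon> \<and> (\<forall>\<omega>\<in>space P - B. norm (ut T \<omega>) \<le> R)"
      using R0 by eventually_elim (auto simp: R_def le_max_iff_disj)
    \<comment> \<open>Indexing by pairs makes the threshold \<eta> below independent of both
      \<open>T\<close> and \<omega>.\<close>
    define I where "I = TT \<times> space P"
    have "\<exists>\<eta>>0. \<forall>i\<in>I. norm (ut (fst i) (snd i)) \<le> R \<longrightarrow> ZT (fst i) (snd i) \<in> K \<longrightarrow>
        (\<forall>j. \<bar>\<alpha> (fst i) $ j\<bar> \<le> \<eta>) \<longrightarrow>
        (\<forall>j. \<theta>s $ j = 0 \<longrightarrow> \<bar>(\<xi> (fst i) (snd i) $ j) powr (-1/q) * inverse \<bar>\<alpha> (fst i) $ j\<bar>\<bar> \<le> \<eta>) \<longrightarrow>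
        (\<forall>j. \<theta>s $ j \<noteq> 0 \<longrightarrow> \<bar>\<xi> (fst i) (snd i) $ j * \<alpha> (fst i) $ j - \<beta> $ j\<bar> \<le> \<eta>) \<longrightarrow>
        (\<forall>u. \<theta>s + diag_mat (\<alpha> (fst i)) *v u \<in> closure \<Theta> \<longrightarrow> norm u \<le> R + 1 \<longrightarrow> \<bar>r (fst i) (snd i) u\<bar> \<le> \<eta>) \<longrightarrow>
        norm (sub_vec J0 (ut (fst i) (snd i))) \<le> e \<and>
        dist (sub_vec J1 (ut (fst i) (snd i))) (?g (ZT (fst i) (snd i))) \<le> e"
        (is "\<exists>\<eta>>0. ?small \<eta>")
      unfolding ut_eq ZT_def \<psi>_def J0_def J1_def
      by (rule penalized_argmax_close[where H="\<lambda>i. H (fst i) (snd i)" and lam=lam and \<Theta>=\<Theta>])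
        (use Theta xi_pos al_nz pen_nonneg pen0 q A2 lam th_max A10_i K e in \<open>auto simp: I_def U_def G_def\<close>)
    then obtain \<eta> where \<eta>: "\<eta> > 0" and small: "?small \<eta>" by blast
    have "R + 1 > 0" by (simp add: R_def)
    have "whp P ?F (\<lambda>T \<omega>. (\<forall>j. \<bar>\<alpha> T $ j\<bar> \<le> \<eta>) \<and>
      (\<forall>j\<in>J0. \<bar>(\<xi> T \<omega> $ j) powr (-1/q) * inverse \<bar>\<alpha> T $ j\<bar>\<bar> \<le> \<eta>) \<and>
      (\<forall>j\<in>J1. \<bar>\<xi> T \<omega> $ j * \<alpha> T $ j - \<beta> $ j\<bar> \<le> \<eta>) \<and>
      (\<forall>u. \<theta>s + diag_mat (\<alpha> T) *v u \<in> closure \<Theta> \<longrightarrow> norm u \<le> R + 1 \<longrightarrow> \<bar>r T \<omega> u\<bar> \<le> \<eta>))"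
      by (intro whp_conj[OF P] small_alpha small_A6 small_A11 small_r \<eta> \<open>R + 1 > 0\<close>)
    then have "whp P ?F (\<lambda>T \<omega>. norm (ut T \<omega>) \<le> R \<longrightarrow> ZT T \<omega> \<in> K \<longrightarrow>
      norm (sub_vec J0 (ut T \<omega>)) \<le> e \<and> dist (sub_vec J1 (ut T \<omega>)) (?g (ZT T \<omega>)) \<le> e)"
    proof (rule whp_mono, intro eventually_along ballI impI, goal_cases)
      case (1 T \<omega>)
      then have "(T, \<omega>) \<in> I" by (simp add: I_def)
      from bspec[OF small this] 1 show ?case by (simp add: J0_def J1_def)
    qed
    with R show "\<exists>A. (\<forall>\<^sub>F T in ?F. \<exists>B\<in>sets P. measure P B \<le> \<epsilon> \<and> (\<forall>\<omega>\<in>space P - B. A T \<omega>)) \<and>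
      whp P ?F (\<lambda>T \<omega>. A T \<omega> \<longrightarrow> ZT T \<omega> \<in> K \<longrightarrow>
        norm (sub_vec J0 (ut T \<omega>)) \<le> e \<and> dist (sub_vec J1 (ut T \<omega>)) (?g (ZT T \<omega>)) \<le> e)"
      by (intro exI[of _ "\<lambda>T \<omega>. norm (ut T \<omega>) \<le> R"] conjI)
  qed

  \<comment> \<open>The two convergence statements\<close>
  have "conv_prob P ?F (\<lambda>T \<omega>. sub_vec J0 (ut T \<omega>)) (\<lambda>\<omega>. 0)"
  proof (rule conv_prob_of_whp[OF P], rule whp_localize[OF P])
    fix e \<epsilon> :: real assume "e > 0" "\<epsilon> > 0"
    \<comment> \<open>Convergence in distribution confines the coefficients to a compact part of
      \<open>G\<close> off an event of mass at most \<epsilon>, which supplies the premise of the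
      closeness statement.\<close>
    obtain K where K: "compact K" "K \<subseteq> G"
      "\<forall>\<^sub>F T in ?F. \<exists>B\<in>sets P. measure P B \<le> \<epsilon> \<and> (\<forall>\<omega>\<in>space P - B. ZT T \<omega> \<in> K)"
      using conv_distr_eventually_in_compact[OF P Z_conv eventually_along[OF ZT_meas] Z_meas G_open Z_G \<open>\<epsilon> > 0\<close>]
      by blast
    have "whp P ?F (\<lambda>T \<omega>. ZT T \<omega> \<in> K \<longrightarrow> dist (sub_vec J0 (ut T \<omega>)) 0 \<le> e)"
      using close[OF K(1,2) \<open>e > 0\<close>] by (rule whp_mono) (auto intro!: eventually_along)
    with K(3) show "\<exists>A. (\<forall>\<^sub>F T in ?F. \<exists>B\<in>sets P. measure P B \<le> \<epsilon> \<and> (\<forall>\<omega>\<in>space P - B. A T \<omega>)) \<and>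
      whp P ?F (\<lambda>T \<omega>. A T \<omega> \<longrightarrow> dist (sub_vec J0 (ut T \<omega>)) 0 \<le> e)"
      by (intro exI[of _ "\<lambda>T \<omega>. ZT T \<omega> \<in> K"] conjI)
  qed
  moreover have "conv_distr P ?F (\<lambda>T \<omega>. sub_vec J1 (ut T \<omega>)) (\<lambda>\<omega>. sub_inv J1 (\<Gamma> \<omega>) *v sub_vec J1 (\<Delta> \<omega> - \<psi>))"
  \<comment> \<open>The limit is first obtained with the symmetric part of \<Gamma>; both limits
    agree almost surely because \<open>pos_def\<close> includes symmetry.\<close>
  proof (rule conv_distr_AE_cong)
    have gZ: "(\<lambda>\<omega>. ?g (Z \<omega>)) \<in> borel_measurable P"
      by (rule measurable_compose[OF Z_meas borel_measurable_block_solution])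
    then show "(\<lambda>\<omega>. ?g (Z \<omega>)) \<in> borel_measurable P" .
    show "conv_distr P ?F (\<lambda>T \<omega>. sub_vec J1 (ut T \<omega>)) (\<lambda>\<omega>. ?g (Z \<omega>))"
    proof (rule conv_distr_continuous_mapping_approx[OF P Z_conv _ Z_meas _ G_open Z_G _ gZ])
      show "\<forall>\<^sub>F T in ?F. (\<lambda>\<omega>. sub_vec J1 (ut T \<omega>)) \<in> borel_measurable P"
      proof (rule eventually_along)
        fix T assume "T \<in> TT"
        have "(\<lambda>x :: real^'p. sub_vec J1 x) \<in> borel_measurable borel"
          by (intro borel_measurable_continuous_onI continuous_intros)
        from measurable_compose[OF ut_meas[OF \<open>T \<in> TT\<close>] this]
        show "(\<lambda>\<omega>. sub_vec J1 (ut T \<omega>)) \<in> borel_measurable P" .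
      qed
      show "continuous_on G ?g" unfolding G_def by (rule continuous_on_block_solution)
      show "whp P ?F (\<lambda>T \<omega>. ZT T \<omega> \<in> K \<longrightarrow> dist (sub_vec J1 (ut T \<omega>)) (?g (ZT T \<omega>)) \<le> e)"
        if "compact K" "K \<subseteq> G" "e > 0" for K e
        using close[OF that] by (rule whp_mono) (auto intro!: eventually_along)
    qed (rule eventually_along[OF ZT_meas])
    show "AE \<omega> in P. ?g (Z \<omega>) = sub_inv J1 (\<Gamma> \<omega>) *v sub_vec J1 (\<Delta> \<omega> - \<psi>)"
      using A10_ii
      by eventually_elim (simp add: block_solution_def Z_def pos_def_def sym_part_symmetric)
    show "(\<lambda>\<omega>. sub_inv J1 (\<Gamma> \<omega>) *v sub_vec J1 (\<Delta> \<omega> - \<psi>)) \<in> borel_measurable P"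
      by (rule borel_measurable_sub_inv_mult[OF A10_meas(2,3)])
  qed
  ultimately show ?thesis by (simp add: ut_def \<psi>_def)
qed

end
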